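(* Let $p>p_{\mathrm F}(n)=1+2/n$, let $f$ satisfy the assumptions in the context, and let $\varepsilon_0>0$ be a constant with the property that for every $\psi\in L^1(\mathbb{R}^n)\cap L^\infty(\mathbb{R}^n)$ with $\|\psi\|_1+\|\psi\|_\infty\le\varepsilon_0$ the Cauchy problem (P) with initial data $\psi$ has a unique global solution $v\in X$, and this solution satisfies $\sup_{q\in[1,+\infty]}\sup_{t\ge0}(1+t)^{\frac n2(1-\frac1q)}\|v(t)\|_q<+\infty$. Let $m$ be a positive integer, let $\varphi\in L^1_m(\mathbb{R}^n)\cap L^\infty(\mathbb{R}^n)$ satisfy $\|\varphi\|_1+\|\varphi\|_\infty\le\varepsilon_0$, and let $u\in X$ be the global solution to (P) with initial data $\varphi$. Then $u\in C([0,+\infty);L^1_m(\mathbb{R}^n))$, and moreover there exists $C_m>0$ such that $$\sum_{|\alpha|=m}\|x^\alpha u(t)\|_1\le C_m\left(1+t^{\frac m2}\right)$$ holds for all $t\ge0$, where the sum is over multi-indices $\alpha\in\mathbb{Z}_{\ge0}^n$ with $|\alpha|=m$.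
   Context: $n\ge1$ is an integer; $\|\cdot\|_q$ is the norm of $L^q(\mathbb{R}^n)$, all functions being real-valued. The nonlinearity $f:\mathbb{R}\to\mathbb{R}$ satisfies $f(0)=0$ and, for some constants $K>0$ and $p\in(1,+\infty)$, $|f(\xi)-f(\eta)|\le K(|\xi|^{p-1}+|\eta|^{p-1})|\xi-\eta|$ for all $\xi,\eta\in\mathbb{R}$. The Cauchy problem (P) is $\partial_t u-\Delta u=f(u)$ in $(0,+\infty)\times\mathbb{R}^n$, $u(0)=\varphi$. Heat semigroup: $e^{t\Delta}\varphi=G_t*\varphi$ for $t>0$ and $e^{0\Delta}\varphi=\varphi$, where $G_t(x)=(4\pi t)^{-n/2}\exp(-|x|^2/(4t))$. $X=(C\cap L^\infty)([0,+\infty);L^1(\mathbb{R}^n))\cap(C\cap L^\infty)((0,+\infty);L^\infty(\mathbb{R}^n))$ (bounded continuous functions of time in both senses). A global solution to (P) in $X$ means $u\in X$ satisfying the integral equation $u(t)=e^{t\Delta}\varphi+\int_0^te^{(t-s)\Delta}f(u(s))\,ds$ for all $t\ge0$. $L^1_m(\mathbb{R}^n)=\{\varphi\in L^1(\mathbb{R}^n): x^\alpha\varphi\in L^1(\mathbb{R}^n)\text{ for all }\alpha\in\mathbb{Z}_{\ge0}^n\text{ with }|\alpha|\le m\}$, with norm $\sum_{|\alpha|\le m}\|x^\alpha\varphi\|_1$; $x^\alpha\varphi$ denotes the function $x\mapsto x^\alpha\varphi(x)$. A constant $\varepsilon_0$ with the stated property exists whenever $p>1+2/n$. *)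

theory Defs
  imports "HOL-Analysis.Analysis" "HOL-Probability.Essential_Supremum"
begin

section \<open>Lebesgue spaces\<close>

text \<open>
  Elements of \<open>L\<^sup>q(\<real>\<^sup>n)\<close> are represented by Borel functions \<open>real ^ 'n \<Rightarrow> real\<close>
  (every class modulo null sets contains one), and equality of classes is written
  as equality almost everywhere. Norms take values in \<open>[0, \<infinity>]\<close>, so that no
  default value of a divergent integral can interfere.
\<close>

definition Lq_norm :: "ennreal \<Rightarrow> (real ^ 'n \<Rightarrow> real) \<Rightarrow> ennreal" where
  "Lq_norm q g =
     (if q = \<infinity> then esssup lborel (\<lambda>x. ennreal \<bar>g x\<bar>)
      else let I = (\<integral>\<^sup>+ x. ennreal (\<bar>g x\<bar> powr enn2real q) \<partial>lborel)
           in if I = \<infinity> then \<infinity> else ennreal (enn2real I powr (1 / enn2real q)))"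

definition Lq :: "ennreal \<Rightarrow> (real ^ 'n \<Rightarrow> real) set" where
  "Lq q = {g. g \<in> borel_measurable lborel \<and> Lq_norm q g < \<infinity>}"

section \<open>Multi-indices and weighted spaces\<close>

definition mi_length :: "('n::finite \<Rightarrow> nat) \<Rightarrow> nat" where
  "mi_length \<alpha> = (\<Sum>i\<in>UNIV. \<alpha> i)"

definition mi_power :: "real ^ 'n \<Rightarrow> ('n::finite \<Rightarrow> nat) \<Rightarrow> real" where
  "mi_power x \<alpha> = (\<Prod>i\<in>UNIV. (x $ i) ^ \<alpha> i)"

text \<open>Sums over multi-indices of bounded length are sums over finite sets.\<close>

lemma finite_mi_length_le: "finite {\<alpha> :: 'n::finite \<Rightarrow> nat. mi_length \<alpha> \<le> m}"
proof (rule finite_subset)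
  have "\<alpha> i \<le> m" if "mi_length \<alpha> \<le> m" for \<alpha> :: "'n \<Rightarrow> nat" and i
    using member_le_sum[of i UNIV \<alpha>] that by (simp add: mi_length_def)
  then show "{\<alpha> :: 'n \<Rightarrow> nat. mi_length \<alpha> \<le> m} \<subseteq> (UNIV \<rightarrow>\<^sub>E {..m})"
    by (auto simp: PiE_def Pi_def)
  show "finite ((UNIV :: 'n set) \<rightarrow>\<^sub>E {..m})"
    by (rule finite_PiE) auto
qed

lemma finite_mi_length_eq: "finite {\<alpha> :: 'n::finite \<Rightarrow> nat. mi_length \<alpha> = m}"
  by (rule finite_subset[OF _ finite_mi_length_le[of m]]) auto

definition L1w :: "nat \<Rightarrow> (real ^ 'n \<Rightarrow> real) set" where
  "L1w m = {g \<in> Lq 1. \<forall>\<alpha>. mi_length \<alpha> \<le> m \<longrightarrow> (\<lambda>x. mi_power x \<alpha> * g x) \<in> Lq 1}"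

definition L1w_norm :: "nat \<Rightarrow> (real ^ 'n \<Rightarrow> real) \<Rightarrow> ennreal" where
  "L1w_norm m g = (\<Sum>\<alpha> | mi_length \<alpha> \<le> m. Lq_norm 1 (\<lambda>x. mi_power x \<alpha> * g x))"

section \<open>Function-valued curves\<close>

text \<open>\<open>continuous_into V N T u\<close> is \<open>u \<in> C(T; V)\<close>, where the function space \<open>V\<close>
  carries the norm \<open>N\<close>; \<open>bounded_into N T u\<close> adds \<open>u \<in> L\<^sup>\<infinity>(T; V)\<close> for such \<open>u\<close>.\<close>

definition continuous_into ::
    "('a \<Rightarrow> real) set \<Rightarrow> (('a \<Rightarrow> real) \<Rightarrow> ennreal) \<Rightarrow> real set \<Rightarrow> (real \<Rightarrow> 'a \<Rightarrow> real) \<Rightarrow> bool" where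
  "continuous_into V N T u \<longleftrightarrow>
     (\<forall>t\<in>T. u t \<in> V) \<and>
     (\<forall>t\<in>T. ((\<lambda>s. N (\<lambda>x. u s x - u t x)) \<longlongrightarrow> 0) (at t within T))"

definition bounded_into ::
    "(('a \<Rightarrow> real) \<Rightarrow> ennreal) \<Rightarrow> real set \<Rightarrow> (real \<Rightarrow> 'a \<Rightarrow> real) \<Rightarrow> bool" where
  "bounded_into N T u \<longleftrightarrow> (SUP t\<in>T. N (u t)) < \<infinity>"

definition X_space :: "(real \<Rightarrow> real ^ 'n \<Rightarrow> real) set" where
  "X_space = {u.
     continuous_into (Lq 1) (Lq_norm 1) {0..} u \<and> bounded_into (Lq_norm 1) {0..} u \<and>
     continuous_into (Lq \<infinity>) (Lq_norm \<infinity>) {0<..} u \<and> bounded_into (Lq_norm \<infinity>) {0<..} u}"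

section \<open>The Cauchy problem\<close>

definition heat_kernel :: "real \<Rightarrow> real ^ 'n \<Rightarrow> real" where
  "heat_kernel t x = (4 * pi * t) powr (- real CARD('n) / 2) * exp (- (norm x)\<^sup>2 / (4 * t))"

definition heat :: "real \<Rightarrow> (real ^ 'n \<Rightarrow> real) \<Rightarrow> real ^ 'n \<Rightarrow> real" where
  "heat t g x = (if t = 0 then g x else (LINT y|lborel. heat_kernel t (x - y) * g y))"

definition nonlinearity :: "(real \<Rightarrow> real) \<Rightarrow> real \<Rightarrow> real \<Rightarrow> bool" where
  "nonlinearity f K p \<longleftrightarrow> f 0 = 0 \<and>
     (\<forall>\<xi> \<eta>. \<bar>f \<xi> - f \<eta>\<bar> \<le> K * (\<bar>\<xi>\<bar> powr (p - 1) + \<bar>\<eta>\<bar> powr (p - 1)) * \<bar>\<xi> - \<eta>\<bar>)"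

text \<open>The time integral in Duhamel's formula is taken pointwise in \<open>x\<close>; it is required to
  exist, as the Lebesgue integral of a non-integrable function is \<open>0\<close> in HOL. For
  \<open>u \<in> X_space\<close> the integral does exist for every \<open>x\<close>: the values \<open>f (u s)\<close>, \<open>s > 0\<close>, are
  uniformly bounded and depend continuously on \<open>s\<close> in the \<open>L\<^sup>1\<close> norm.\<close>

definition global_solution ::
    "(real \<Rightarrow> real) \<Rightarrow> (real ^ 'n \<Rightarrow> real) \<Rightarrow> (real \<Rightarrow> real ^ 'n \<Rightarrow> real) \<Rightarrow> bool" where
  "global_solution f \<phi> u \<longleftrightarrow> u \<in> X_space \<and>
     (\<forall>t\<ge>0. AE x in lborel.
        set_integrable lborel {0..t} (\<lambda>s. heat (t - s) (\<lambda>y. f (u s y)) x) \<and>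
        u t x = heat t \<phi> x + (LINT s:{0..t}|lborel. heat (t - s) (\<lambda>y. f (u s y)) x))"

text \<open>The convention \<open>inverse \<infinity> = 0\<close> on \<open>ennreal\<close> gives the exponent \<open>n / 2\<close> at \<open>q = \<infinity>\<close>.\<close>

definition decaying :: "(real \<Rightarrow> real ^ 'n \<Rightarrow> real) \<Rightarrow> bool" where
  "decaying v \<longleftrightarrow>
     (SUP q\<in>{1..}. SUP t\<in>{0..}.
        ennreal ((1 + t) powr (real CARD('n) / 2 * (1 - enn2real (inverse q)))) * Lq_norm q (v t)) < \<infinity>"

text \<open>\<open>eps\<close> is a smallness threshold for global well-posedness with decay.\<close>

definition smallness_constant :: "'n::finite itself \<Rightarrow> (real \<Rightarrow> real) \<Rightarrow> real \<Rightarrow> bool" where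
  "smallness_constant _ f eps \<longleftrightarrow>
     (\<forall>\<psi> :: real ^ 'n \<Rightarrow> real.
        \<psi> \<in> Lq 1 \<inter> Lq \<infinity> \<and> Lq_norm 1 \<psi> + Lq_norm \<infinity> \<psi> \<le> ennreal eps \<longrightarrow>
        (\<exists>v. global_solution f \<psi> v \<and>
             (\<forall>w. global_solution f \<psi> w \<longrightarrow> (\<forall>t\<ge>0. AE x in lborel. w t x = v t x)) \<and>
             decaying v))"

end

theory Submission
  imports Defs "HOL-Probability.Distributions"
begin

text \<open>
  Decay gives \<open>\<bar>f (u s)\<bar> \<le> h s * \<bar>u s\<bar>\<close> with \<open>h s = c (1 + s) powr - \<gamma>\<close> and
  \<open>\<gamma> = n (p - 1) / 2 > 1\<close>, so \<open>h\<close> is integrable in time. Fix \<open>T\<close> and a bounded weight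
  \<open>\<psi> \<ge> 0\<close>, and transport the weight backwards: by Duhamel's formula, Tonelli's theorem and the
  semigroup property, \<open>m t = \<integral> (e\<^bsup>(T - t)\<Delta>\<^esup> \<psi>) \<bar>u t\<bar>\<close> satisfies
  \<open>m t \<le> \<integral> (e\<^bsup>T\<Delta>\<^esup> \<psi>) \<bar>\<phi>\<bar> + \<integral>\<^sub>0\<^sup>t h s * m s ds\<close>. Gronwall's inequality at \<open>t = T\<close>,
  followed by monotone convergence in \<open>\<psi>\<close>, yields
  \<open>\<integral> \<psi> \<bar>u T\<bar> \<le> B \<integral> \<bar>\<phi>\<bar> e\<^bsup>T\<Delta>\<^esup> \<psi>\<close> for every measurable \<open>\<psi> \<ge> 0\<close>, with \<open>B\<close>
  independent of \<open>T\<close>. The weight \<open>\<bar>x\<bar>\<^sup>m\<close> gives the growth bound. The weight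
  \<open>(1 + \<bar>x\<bar>)\<^sup>m\<close> restricted to \<open>\<bar>x\<bar> > R\<close> gives tails that are small uniformly for bounded
  times, which upgrades continuity in \<open>L\<^sup>1\<close> to continuity in the weighted space.
\<close>

section \<open>The heat kernel\<close>

lemma heat_kernel_nonneg: "0 \<le> heat_kernel t x"
  by (simp add: heat_kernel_def)

lemma heat_kernel_minus: "heat_kernel t (- x) = heat_kernel t x"
  by (simp add: heat_kernel_def)

lemma heat_kernel_commute: "heat_kernel t (x - y) = heat_kernel t (y - x)"
  using heat_kernel_minus[of t "x - y"] by simp

lemma heat_kernel_measurable [measurable]:
  "heat_kernel t \<in> borel_measurable borel"
  unfolding heat_kernel_def by measurable

lemma heat_kernel_le: "0 < t \<Longrightarrow> heat_kernel t (x :: real ^ 'n) \<le> (4 * pi * t) powr (- real CARD('n) / 2)"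
  unfolding heat_kernel_def by (rule mult_left_le) (auto simp: divide_nonpos_pos)

text \<open>The kernel is a Gaussian with independent coordinates of variance \<open>2 * t\<close>.
  This reduces its total mass and its convolution law to facts about one-dimensional normal
  densities.\<close>

lemma heat_kernel_eq_prod:
  assumes "0 < t"
  shows "heat_kernel t (x :: real ^ 'n) = (\<Prod>b\<in>Basis. normal_density 0 (sqrt (2 * t)) (x \<bullet> b))"
proof -
  have pos: "0 < 4 * pi * t"
    using assms by simp
  have "(4 * pi * t) powr (- real CARD('n) / 2) = (1 / sqrt (4 * pi * t)) ^ CARD('n)"
  proof -
    have "1 / sqrt (4 * pi * t) = (4 * pi * t) powr (- (1 / 2))"
      using pos by (simp only: powr_minus_divide powr_half_sqrt)
    moreover have "((4 * pi * t) powr (- (1 / 2))) ^ CARD('n) = (4 * pi * t) powr (- real CARD('n) / 2)"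
      using pos by (subst powr_realpow[symmetric]) (simp_all only: powr_powr powr_gt_zero, simp_all)
    ultimately show ?thesis
      by simp
  qed
  moreover have "(\<Prod>b\<in>Basis. exp (- (x \<bullet> b)\<^sup>2 / (4 * t))) = exp (- (norm x)\<^sup>2 / (4 * t))"
    unfolding exp_sum[OF finite_Basis, symmetric] power2_norm_eq_inner euclidean_inner[of x x]
    by (simp add: sum_negf sum_divide_distrib power2_eq_square)
  ultimately show ?thesis
    using assms by (simp add: heat_kernel_def normal_density_def prod_dividef power_one_over mult.assoc)
qed

lemma nn_integral_shift:
  fixes g :: "'a::euclidean_space \<Rightarrow> ennreal"
  assumes [measurable]: "g \<in> borel_measurable borel"
  shows "(\<integral>\<^sup>+x. g (c + x) \<partial>lborel) = (\<integral>\<^sup>+x. g x \<partial>lborel)"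
proof -
  have "(\<integral>\<^sup>+x. g x \<partial>lborel) = (\<integral>\<^sup>+x. g x \<partial>distr lborel borel ((+) c))"
    by (simp only: lborel_distr_plus)
  also have "\<dots> = (\<integral>\<^sup>+x. g (c + x) \<partial>lborel)"
    by (subst nn_integral_distr) auto
  finally show ?thesis ..
qed

lemma nn_integral_scale:
  fixes g :: "'a::euclidean_space \<Rightarrow> ennreal"
  assumes [measurable]: "g \<in> borel_measurable borel" and "0 < c"
  shows "(\<integral>\<^sup>+x. g x \<partial>lborel) = (\<integral>\<^sup>+x. ennreal (c ^ DIM('a)) * g (c *\<^sub>R x) \<partial>lborel)"
  using assms(2)
  by (subst lborel_affine[of c 0]) (simp_all add: nn_integral_density nn_integral_distr)

lemma nn_integral_heat_kernel:
  assumes "0 < t"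
  shows "(\<integral>\<^sup>+x. ennreal (heat_kernel t (x :: real ^ 'n)) \<partial>lborel) = 1"
proof -
  have *: "(\<integral>\<^sup>+x. ennreal (normal_density 0 (sqrt (2 * t)) x) \<partial>lborel) = 1"
    using assms by (subst nn_integral_eq_integral) (auto simp: normal_density_nonneg)
  have "(\<integral>\<^sup>+x. ennreal (heat_kernel t (x :: real ^ 'n)) \<partial>lborel) =
      (\<integral>\<^sup>+x. (\<Prod>b\<in>Basis. ennreal (normal_density 0 (sqrt (2 * t)) ((x :: real ^ 'n) \<bullet> b))) \<partial>lborel)"
    by (simp add: heat_kernel_eq_prod[OF assms] prod_ennreal normal_density_nonneg)
  also have "\<dots> = 1"
    by (subst nn_integral_lborel_prod) (auto simp: *)
  finally show ?thesis .
qed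

text \<open>After a translation by \<open>z\<close> both kernels split over the coordinates, where
  centred normal densities convolve by adding their variances \<open>2 * s\<close> and
  \<open>2 * t\<close>.\<close>

lemma heat_kernel_convolution:
  fixes x z :: "real ^ 'n"
  assumes "0 < s" "0 < t"
  shows "(\<integral>\<^sup>+y. ennreal (heat_kernel s (x - y)) * ennreal (heat_kernel t (y - z)) \<partial>lborel) =
    ennreal (heat_kernel (s + t) (x - z))"
proof -
  let ?n = "\<lambda>t. normal_density 0 (sqrt (2 * t))"
  have *: "(\<integral>\<^sup>+y. ennreal (?n s (a - y)) * ennreal (?n t y) \<partial>lborel) = ennreal (?n (s + t) a)" for a
    using assms fun_cong[OF conv_normal_density_zero_mean[of "sqrt (2 * s)" "sqrt (2 * t)"], of a]
    by (simp add: ennreal_mult normal_density_nonneg algebra_simps)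
  have "(\<integral>\<^sup>+y. ennreal (heat_kernel s (x - y)) * ennreal (heat_kernel t (y - z)) \<partial>lborel) =
     (\<integral>\<^sup>+y. ennreal (heat_kernel s (x - z - y)) * ennreal (heat_kernel t y) \<partial>lborel)"
    by (subst nn_integral_shift[of _ z, symmetric]) (simp_all add: algebra_simps)
  also have "\<dots> = (\<integral>\<^sup>+y. (\<Prod>b\<in>Basis. ennreal (?n s ((x - z) \<bullet> b - y \<bullet> b)) * ennreal (?n t (y \<bullet> b))) \<partial>lborel)"
    using assms
    by (simp add: heat_kernel_eq_prod prod_ennreal normal_density_nonneg prod.distrib inner_diff_left)
  also have "\<dots> = (\<Prod>b\<in>Basis. \<integral>\<^sup>+y. ennreal (?n s ((x - z) \<bullet> b - y)) * ennreal (?n t y) \<partial>lborel)"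
    by (rule nn_integral_lborel_prod) auto
  also have "\<dots> = ennreal (heat_kernel (s + t) (x - z))"
    using assms by (simp only: *) (simp add: heat_kernel_eq_prod prod_ennreal normal_density_nonneg)
  finally show ?thesis .
qed

text \<open>Self-similarity: in the parabolic variable every kernel becomes the one at time 1, with
  the Jacobian of the scaling included.\<close>

lemma heat_kernel_scale:
  assumes "0 < t"
  shows "sqrt t ^ CARD('n) * heat_kernel t (sqrt t *\<^sub>R x) = heat_kernel 1 (x :: real ^ 'n)"
proof -
  have "sqrt t ^ CARD('n) = t powr (real CARD('n) / 2)"
    using assms by (simp add: powr_half_sqrt[symmetric] powr_realpow[symmetric] powr_powr)
  then show ?thesis
    using assms by (simp add: heat_kernel_def powr_mult power_mult_distrib powr_add[symmetric])
qed

text \<open>The semigroup is taken with values in \<open>ennreal\<close>, so that weights may be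
  unbounded and no integrability has to be checked. The branch at \<open>t = 0\<close> matches that
  of \<open>heat\<close>.\<close>

definition heat_nn :: "real \<Rightarrow> (real ^ 'n \<Rightarrow> ennreal) \<Rightarrow> real ^ 'n \<Rightarrow> ennreal" where
  "heat_nn t g x = (if t = 0 then g x else (\<integral>\<^sup>+y. ennreal (heat_kernel t (x - y)) * g y \<partial>lborel))"

lemma heat_nn_measurable [measurable]:
  assumes [measurable]: "g \<in> borel_measurable borel"
  shows "heat_nn t g \<in> borel_measurable borel"
  unfolding heat_nn_def by measurable

lemma heat_nn_mono: "(\<And>x. g x \<le> g' x) \<Longrightarrow> heat_nn t g x \<le> heat_nn t g' x"
  unfolding heat_nn_def by (auto intro!: nn_integral_mono mult_left_mono)

text \<open>The substitution \<open>y = x + sqrt t z\<close> freezes the kernel at time 1 and leaves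
  \<open>t\<close> only in the argument of \<open>g\<close>, so estimates uniform in
  \<open>t\<close> become pointwise ones. The formula includes \<open>t = 0\<close> because the
  kernel has mass one.\<close>

lemma heat_nn_eq_gaussian:
  fixes g :: "real ^ 'n \<Rightarrow> ennreal"
  assumes [measurable]: "g \<in> borel_measurable borel" and "0 \<le> t"
  shows "heat_nn t g x = (\<integral>\<^sup>+z. ennreal (heat_kernel 1 z) * g (x + sqrt t *\<^sub>R z) \<partial>lborel)"
proof (cases "t = 0")
  case True
  then show ?thesis
    by (simp add: heat_nn_def nn_integral_multc nn_integral_heat_kernel)
next
  case False
  then have t: "0 < t"
    using assms by simp
  have "heat_nn t g x = (\<integral>\<^sup>+y. ennreal (heat_kernel t y) * g (x + y) \<partial>lborel)"
    using False unfolding heat_nn_def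
    by (subst nn_integral_shift[of _ x, symmetric]) (simp_all add: heat_kernel_minus)
  also have "\<dots> = (\<integral>\<^sup>+z. ennreal (sqrt t ^ CARD('n) * heat_kernel t (sqrt t *\<^sub>R z)) * g (x + sqrt t *\<^sub>R z) \<partial>lborel)"
    using t by (subst nn_integral_scale[of _ "sqrt t"])
       (simp_all add: ennreal_mult heat_kernel_nonneg mult.assoc)
  finally show ?thesis
    by (simp only: heat_kernel_scale[OF t])
qed

lemma heat_nn_le_const:
  fixes g :: "real ^ 'n \<Rightarrow> ennreal"
  assumes [measurable]: "g \<in> borel_measurable borel" and "0 \<le> t" and "\<And>x. g x \<le> c"
  shows "heat_nn t g x \<le> c"
proof -
  have "heat_nn t g x \<le> (\<integral>\<^sup>+z. ennreal (heat_kernel 1 (z :: real ^ 'n)) * c \<partial>lborel)"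
    unfolding heat_nn_eq_gaussian[OF assms(1,2)] using assms(3) by (intro nn_integral_mono mult_left_mono) auto
  then show ?thesis
    by (simp add: nn_integral_multc nn_integral_heat_kernel)
qed

text \<open>Tonelli's theorem and the evenness of the kernel. This is what moves the semigroup from
  the solution onto the weight.\<close>

lemma nn_integral_heat_nn_adjoint:
  fixes g h :: "real ^ 'n \<Rightarrow> ennreal"
  assumes [measurable]: "g \<in> borel_measurable borel" "h \<in> borel_measurable borel"
  shows "(\<integral>\<^sup>+x. g x * heat_nn t h x \<partial>lborel) = (\<integral>\<^sup>+x. heat_nn t g x * h x \<partial>lborel)"
proof (cases "t = 0")
  case True
  then show ?thesis
    by (simp add: heat_nn_def)
next
  case False
  then have "(\<integral>\<^sup>+x. g x * heat_nn t h x \<partial>lborel) =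
      (\<integral>\<^sup>+x. \<integral>\<^sup>+y. g x * (ennreal (heat_kernel t (x - y)) * h y) \<partial>lborel \<partial>lborel)"
    by (simp add: heat_nn_def nn_integral_cmult)
  also have "\<dots> = (\<integral>\<^sup>+y. \<integral>\<^sup>+x. g x * (ennreal (heat_kernel t (x - y)) * h y) \<partial>lborel \<partial>lborel)"
    by (rule lborel_pair.Fubini') measurable
  also have "\<dots> = (\<integral>\<^sup>+y. \<integral>\<^sup>+x. ennreal (heat_kernel t (y - x)) * g x * h y \<partial>lborel \<partial>lborel)"
    by (subst heat_kernel_commute) (simp add: mult_ac)
  also have "\<dots> = (\<integral>\<^sup>+y. heat_nn t g y * h y \<partial>lborel)"
    using False by (simp add: heat_nn_def nn_integral_multc)
  finally show ?thesis .
qed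

lemma heat_nn_heat_nn:
  fixes g :: "real ^ 'n \<Rightarrow> ennreal"
  assumes [measurable]: "g \<in> borel_measurable borel" and "0 \<le> s" "0 \<le> t"
  shows "heat_nn s (heat_nn t g) x = heat_nn (s + t) g x"
proof (cases "s = 0 \<or> t = 0")
  case True
  then show ?thesis
    by (auto simp: heat_nn_def)
next
  case False
  then have pos: "0 < s" "0 < t"
    using assms by auto
  then have "heat_nn s (heat_nn t g) x =
      (\<integral>\<^sup>+y. \<integral>\<^sup>+z. ennreal (heat_kernel s (x - y)) * (ennreal (heat_kernel t (y - z)) * g z) \<partial>lborel \<partial>lborel)"
    by (simp add: heat_nn_def nn_integral_cmult)
  also have "\<dots> = (\<integral>\<^sup>+z. \<integral>\<^sup>+y. ennreal (heat_kernel s (x - y)) * (ennreal (heat_kernel t (y - z)) * g z) \<partial>lborel \<partial>lborel)"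
    by (rule lborel_pair.Fubini') measurable
  also have "\<dots> = (\<integral>\<^sup>+z. ennreal (heat_kernel (s + t) (x - z)) * g z \<partial>lborel)"
    using pos by (simp add: mult.assoc[symmetric] nn_integral_multc heat_kernel_convolution)
  finally show ?thesis
    using pos by (simp add: heat_nn_def)
qed

text \<open>No integrability is assumed: if the integrand is not integrable, the Bochner integral in
  \<open>heat\<close> has the default value 0 and the bound is trivial.\<close>

lemma heat_abs_le:
  "ennreal \<bar>heat t g x\<bar> \<le> heat_nn t (\<lambda>y. ennreal \<bar>g y\<bar>) x"
proof (cases "t = 0 \<or> \<not> integrable lborel (\<lambda>y. heat_kernel t (x - y) * g y)")
  case True
  then show ?thesis
    by (auto simp: heat_def heat_nn_def not_integrable_integral_eq)
next
  case False
  then have "ennreal \<bar>heat t g x\<bar> \<le> (\<integral>\<^sup>+y. ennreal (norm (heat_kernel t (x - y) * g y)) \<partial>lborel)"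
    using integral_norm_bound_ennreal[of lborel "\<lambda>y. heat_kernel t (x - y) * g y"] by (simp add: heat_def)
  then show ?thesis
    using False by (simp add: heat_nn_def abs_mult heat_kernel_nonneg ennreal_mult)
qed

section \<open>The Duhamel integral\<close>

lemma norm_integral_le_nn_integral:
  fixes g :: "'a \<Rightarrow> 'b::{banach, second_countable_topology}"
  shows "ennreal (norm (LINT x|M. g x)) \<le> (\<integral>\<^sup>+x. ennreal (norm (g x)) \<partial>M)"
  by (cases "integrable M g") (auto simp: integral_norm_bound_ennreal not_integrable_integral_eq)

lemma heat_kernel_tendsto:
  fixes x :: "real ^ 'n"
  assumes "t \<longlonglongrightarrow> s" "x' \<longlonglongrightarrow> x" "0 < s"
  shows "(\<lambda>k. heat_kernel (t k) (x' k)) \<longlonglongrightarrow> heat_kernel s x"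
  using assms unfolding heat_kernel_def by (auto intro!: tendsto_intros)

lemma heat_integrable:
  fixes g :: "real ^ 'n \<Rightarrow> real"
  assumes "0 < t" "integrable lborel g"
  shows "integrable lborel (\<lambda>y. heat_kernel t (x - y) * g y)"
proof (rule Bochner_Integration.integrable_bound)
  show "integrable lborel (\<lambda>y. (4 * pi * t) powr (- real CARD('n) / 2) * g y)"
    using assms by simp
  show "AE y in lborel. norm (heat_kernel t (x - y) * g y) \<le> norm ((4 * pi * t) powr (- real CARD('n) / 2) * g y)"
    using heat_kernel_le[OF assms(1), where ?'n = 'n]
    by (auto simp: abs_mult heat_kernel_nonneg intro!: mult_right_mono)
qed (use assms in measurable)

text \<open>Joint continuity in time, position and \<open>L1\<close> data. The change of kernel
  against the fixed \<open>g\<close> is handled by dominated convergence; the change of data costs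
  at most a uniform bound on the kernels times the \<open>L1\<close> distance.\<close>

lemma heat_tendsto:
  fixes g :: "real ^ 'n \<Rightarrow> real"
  assumes t: "t \<longlonglongrightarrow> s" "\<And>k. 0 < t k" "0 < s" and x: "x' \<longlonglongrightarrow> x"
    and int: "\<And>k. integrable lborel (g' k)" "integrable lborel g"
    and lim: "(\<lambda>k. \<integral>\<^sup>+y. ennreal \<bar>g' k y - g y\<bar> \<partial>lborel) \<longlonglongrightarrow> 0"
  shows "(\<lambda>k. heat (t k) (g' k) (x' k)) \<longlonglongrightarrow> heat s g x"
proof -
  have [measurable]: "g \<in> borel_measurable borel" "g' k \<in> borel_measurable borel" for k
    using int borel_measurable_integrable by fastforce+
  \<comment> \<open>The limit time is positive, so the maxima of the kernels converge and have a
    common bound \<open>C\<close>.\<close>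
  have "(\<lambda>k. (4 * pi * t k) powr (- real CARD('n) / 2)) \<longlonglongrightarrow> (4 * pi * s) powr (- real CARD('n) / 2)"
    using t by (auto intro!: tendsto_intros)
  then have "Bseq (\<lambda>k. (4 * pi * t k) powr (- real CARD('n) / 2))"
    by (rule convergent_imp_Bseq[OF convergentI])
  then obtain C where C: "\<And>k. (4 * pi * t k) powr (- real CARD('n) / 2) \<le> C" "0 < C"
    by (rule BseqE) auto
  have le: "heat_kernel (t k) (z :: real ^ 'n) \<le> C" for k z
    using heat_kernel_le[OF t(2)] C(1) order_trans by blast
  have 1: "(\<lambda>k. LINT y|lborel. heat_kernel (t k) (x' k - y) * g y) \<longlonglongrightarrow>
      (LINT y|lborel. heat_kernel s (x - y) * g y)"
  proof (rule integral_dominated_convergence[where w = "\<lambda>y. C * \<bar>g y\<bar>"])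
    show "integrable lborel (\<lambda>y. C * \<bar>g y\<bar>)"
      using int by simp
    show "AE y in lborel. (\<lambda>k. heat_kernel (t k) (x' k - y) * g y) \<longlonglongrightarrow> heat_kernel s (x - y) * g y"
      using t x by (auto intro!: tendsto_intros heat_kernel_tendsto)
    show "AE y in lborel. norm (heat_kernel (t k) (x' k - y) * g y) \<le> C * \<bar>g y\<bar>" for k
      using le by (auto simp: abs_mult heat_kernel_nonneg intro!: mult_right_mono)
  qed (use int in measurable)
  have "(\<lambda>k. ennreal \<bar>LINT y|lborel. heat_kernel (t k) (x' k - y) * (g' k y - g y)\<bar>) \<longlonglongrightarrow> 0"
  proof (rule tendsto_sandwich[OF _ _ tendsto_const])
    have "ennreal \<bar>LINT y|lborel. heat_kernel (t k) (x' k - y) * (g' k y - g y)\<bar> \<le>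
        ennreal C * (\<integral>\<^sup>+y. ennreal \<bar>g' k y - g y\<bar> \<partial>lborel)" for k
    proof -
      have "ennreal \<bar>LINT y|lborel. heat_kernel (t k) (x' k - y) * (g' k y - g y)\<bar> \<le>
          (\<integral>\<^sup>+y. ennreal \<bar>heat_kernel (t k) (x' k - y) * (g' k y - g y)\<bar> \<partial>lborel)"
        using norm_integral_le_nn_integral[of lborel "\<lambda>y. heat_kernel (t k) (x' k - y) * (g' k y - g y)"]
        by simp
      also have "\<dots> \<le> (\<integral>\<^sup>+y. ennreal C * ennreal \<bar>g' k y - g y\<bar> \<partial>lborel)"
        using le C(2)
        by (auto simp: abs_mult heat_kernel_nonneg ennreal_mult[symmetric] intro!: nn_integral_mono ennreal_leI mult_right_mono)
      also have "\<dots> = ennreal C * (\<integral>\<^sup>+y. ennreal \<bar>g' k y - g y\<bar> \<partial>lborel)"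
        by (rule nn_integral_cmult) measurable
      finally show ?thesis .
    qed
    then show "eventually (\<lambda>k. ennreal \<bar>LINT y|lborel. heat_kernel (t k) (x' k - y) * (g' k y - g y)\<bar> \<le>
        ennreal C * (\<integral>\<^sup>+y. ennreal \<bar>g' k y - g y\<bar> \<partial>lborel)) sequentially"
      by simp
    show "(\<lambda>k. ennreal C * (\<integral>\<^sup>+y. ennreal \<bar>g' k y - g y\<bar> \<partial>lborel)) \<longlonglongrightarrow> 0"
      using tendsto_mult_ennreal[OF tendsto_const lim, of "ennreal C"] by simp
  qed simp
  then have "(\<lambda>k. \<bar>LINT y|lborel. heat_kernel (t k) (x' k - y) * (g' k y - g y)\<bar>) \<longlonglongrightarrow> 0"
    by (subst (asm) ennreal_0[symmetric], subst (asm) tendsto_ennreal_iff) auto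
  then have 2: "(\<lambda>k. LINT y|lborel. heat_kernel (t k) (x' k - y) * (g' k y - g y)) \<longlonglongrightarrow> 0"
    by (rule tendsto_rabs_zero_cancel)
  have "heat (t k) (g' k) (x' k) = (LINT y|lborel. heat_kernel (t k) (x' k - y) * g y)
      + (LINT y|lborel. heat_kernel (t k) (x' k - y) * (g' k y - g y))" for k
    using t(2)[of k] int heat_integrable[OF t(2)]
    by (subst Bochner_Integration.integral_add[symmetric]) (auto simp: heat_def algebra_simps)
  then show ?thesis
    using tendsto_add[OF 1 2] t(3) by (simp add: heat_def)
qed

text \<open>Tonelli's theorem in Duhamel's formula needs joint measurability in
  \<open>(s, x)\<close>, while \<open>F\<close> is only known to be a continuous curve in
  \<open>L1\<close>. Smoothing supplies it: on the open slab \<open>0 < s < t\<close> the integrand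
  is jointly continuous.\<close>

lemma heat_borel_measurable_pair:
  fixes F :: "real \<Rightarrow> real ^ 'n \<Rightarrow> real"
  assumes int: "\<And>s. 0 < s \<Longrightarrow> integrable lborel (F s)"
    and cont: "\<And>s. 0 < s \<Longrightarrow> ((\<lambda>r. \<integral>\<^sup>+y. ennreal \<bar>F r y - F s y\<bar> \<partial>lborel) \<longlongrightarrow> 0) (at s within {0<..})"
  shows "(\<lambda>z. indicator ({0<..<t} \<times> UNIV) z *\<^sub>R heat (t - fst z) (F (fst z)) (snd z)) \<in> borel_measurable borel"
proof (rule borel_measurable_continuous_on_indicator)
  show "{0<..<t} \<times> UNIV \<in> sets (borel :: (real \<times> (real ^ 'n)) measure)"
    by (intro borel_open open_Times) auto
  show "continuous_on ({0<..<t} \<times> UNIV) (\<lambda>z. heat (t - fst z) (F (fst z)) (snd z))"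
    unfolding continuous_on_sequentially
  proof (intro ballI allI impI, elim conjE)
    fix z :: "nat \<Rightarrow> real \<times> (real ^ 'n)" and a
    assume a: "a \<in> {0<..<t} \<times> UNIV" and z: "\<forall>n. z n \<in> {0<..<t} \<times> UNIV" and lim: "z \<longlonglongrightarrow> a"
    have fst: "(\<lambda>n. fst (z n)) \<longlonglongrightarrow> fst a" and snd: "(\<lambda>n. snd (z n)) \<longlonglongrightarrow> snd a"
      using lim by (auto intro: tendsto_fst tendsto_snd)
    have z0: "0 < fst (z n)" "fst (z n) < t" for n
      using z by (auto simp: mem_Times_iff)
    \<comment> \<open>Rewriting the limit 0 as the value at \<open>fst a\<close> turns a punctured
      limit into continuity, which also applies to sequences that hit \<open>fst a\<close>.\<close>
    have "((\<lambda>r. \<integral>\<^sup>+y. ennreal \<bar>F r y - F (fst a) y\<bar> \<partial>lborel) \<longlongrightarrow> (\<integral>\<^sup>+y. ennreal \<bar>F (fst a) y - F (fst a) y\<bar> \<partial>lborel))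
        (at (fst a) within {0<..})"
      using cont[of "fst a"] a by auto
    then have "continuous (at (fst a) within {0<..}) (\<lambda>r. \<integral>\<^sup>+y. ennreal \<bar>F r y - F (fst a) y\<bar> \<partial>lborel)"
      by (simp add: continuous_within)
    then have "(\<lambda>n. \<integral>\<^sup>+y. ennreal \<bar>F (fst (z n)) y - F (fst a) y\<bar> \<partial>lborel) \<longlonglongrightarrow> 0"
      using z0 fst by (auto simp: continuous_within_sequentially o_def)
    then have "(\<lambda>n. heat (t - fst (z n)) (F (fst (z n))) (snd (z n))) \<longlonglongrightarrow> heat (t - fst a) (F (fst a)) (snd a)"
      using a z0 int by (intro heat_tendsto tendsto_intros fst snd) auto
    then show "((\<lambda>z. heat (t - fst z) (F (fst z)) (snd z)) \<circ> z) \<longlonglongrightarrow> heat (t - fst a) (F (fst a)) (snd a)"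
      by (simp add: o_def)
  qed
qed

text \<open>The triangle inequality is applied under the integral, Tonelli's theorem exchanges
  \<open>s\<close> and \<open>x\<close>, and both heat operators are then passed to the weight by
  \<open>nn_integral_heat_nn_adjoint\<close>.\<close>

lemma nn_integral_duhamel_le:
  fixes F :: "real \<Rightarrow> real ^ 'n \<Rightarrow> real" and \<psi> :: "real ^ 'n \<Rightarrow> ennreal"
  assumes int: "\<And>s. 0 < s \<Longrightarrow> integrable lborel (F s)"
    and cont: "\<And>s. 0 < s \<Longrightarrow> ((\<lambda>r. \<integral>\<^sup>+y. ennreal \<bar>F r y - F s y\<bar> \<partial>lborel) \<longlongrightarrow> 0) (at s within {0<..})"
    and [measurable]: "\<phi> \<in> borel_measurable borel" "\<psi> \<in> borel_measurable borel"
  shows "(\<integral>\<^sup>+x. \<psi> x * ennreal \<bar>heat t \<phi> x + (LINT s:{0..t}|lborel. heat (t - s) (F s) x)\<bar> \<partial>lborel) \<le>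
    (\<integral>\<^sup>+y. heat_nn t \<psi> y * ennreal \<bar>\<phi> y\<bar> \<partial>lborel) +
    (\<integral>\<^sup>+s. indicator {0<..<t} s * (\<integral>\<^sup>+y. heat_nn (t - s) \<psi> y * ennreal \<bar>F s y\<bar> \<partial>lborel) \<partial>lborel)"
proof -
  \<comment> \<open>\<open>J\<close> is the Duhamel integrand cut off to the open slab where it is
    jointly measurable; the lost times 0 and \<open>t\<close> form a null set.\<close>
  define J where "J s x = indicator ({0<..<t} \<times> UNIV) (s, x) *\<^sub>R heat (t - s) (F s) x" for s x
  have [measurable]: "(\<lambda>z. J (fst z) (snd z)) \<in> borel_measurable (borel \<Otimes>\<^sub>M borel)"
    unfolding J_def borel_prod using heat_borel_measurable_pair[OF int cont] by simp
  have J': "(\<lambda>(x, s). J s x) \<in> borel_measurable (borel \<Otimes>\<^sub>M borel)"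
    using measurable_compose[OF measurable_pair_swap'[of borel borel] \<open>(\<lambda>z. J (fst z) (snd z)) \<in> _\<close>]
    by (simp add: case_prod_beta)
  note [measurable] = J'
  have le: "ennreal \<bar>heat t \<phi> x + (LINT s:{0..t}|lborel. heat (t - s) (F s) x)\<bar> \<le>
      heat_nn t (\<lambda>y. ennreal \<bar>\<phi> y\<bar>) x + (\<integral>\<^sup>+s. ennreal \<bar>J s x\<bar> \<partial>lborel)" for x
  proof -
    have "ennreal \<bar>LINT s:{0..t}|lborel. heat (t - s) (F s) x\<bar> \<le>
        (\<integral>\<^sup>+s. ennreal (norm (indicator {0..t} s *\<^sub>R heat (t - s) (F s) x)) \<partial>lborel)"
      unfolding set_lebesgue_integral_def real_norm_def[symmetric] by (rule norm_integral_le_nn_integral)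
    also have "\<dots> = (\<integral>\<^sup>+s. ennreal \<bar>J s x\<bar> \<partial>lborel)"
      using AE_lborel_singleton[of "0 :: real"] AE_lborel_singleton[of t]
      by (intro nn_integral_cong_AE) (auto simp: J_def indicator_def)
    finally have "ennreal \<bar>LINT s:{0..t}|lborel. heat (t - s) (F s) x\<bar> \<le> (\<integral>\<^sup>+s. ennreal \<bar>J s x\<bar> \<partial>lborel)" .
    moreover have "ennreal \<bar>heat t \<phi> x + (LINT s:{0..t}|lborel. heat (t - s) (F s) x)\<bar> \<le>
        ennreal \<bar>heat t \<phi> x\<bar> + ennreal \<bar>LINT s:{0..t}|lborel. heat (t - s) (F s) x\<bar>"
      by (simp del: ennreal_plus add: ennreal_plus[symmetric] abs_triangle_ineq ennreal_leI)
    ultimately show ?thesis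
      using heat_abs_le[of t \<phi> x] by (meson add_mono order_trans)
  qed
  have "(\<integral>\<^sup>+x. \<psi> x * ennreal \<bar>heat t \<phi> x + (LINT s:{0..t}|lborel. heat (t - s) (F s) x)\<bar> \<partial>lborel) \<le>
      (\<integral>\<^sup>+x. \<psi> x * (heat_nn t (\<lambda>y. ennreal \<bar>\<phi> y\<bar>) x + (\<integral>\<^sup>+s. ennreal \<bar>J s x\<bar> \<partial>lborel)) \<partial>lborel)"
    using le by (intro nn_integral_mono mult_left_mono) auto
  also have "\<dots> = (\<integral>\<^sup>+x. \<psi> x * heat_nn t (\<lambda>y. ennreal \<bar>\<phi> y\<bar>) x \<partial>lborel) +
      (\<integral>\<^sup>+x. \<psi> x * (\<integral>\<^sup>+s. ennreal \<bar>J s x\<bar> \<partial>lborel) \<partial>lborel)"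
    unfolding distrib_left by (rule nn_integral_add) measurable
  also have "(\<integral>\<^sup>+x. \<psi> x * (\<integral>\<^sup>+s. ennreal \<bar>J s x\<bar> \<partial>lborel) \<partial>lborel) =
      (\<integral>\<^sup>+x. \<integral>\<^sup>+s. \<psi> x * ennreal \<bar>J s x\<bar> \<partial>lborel \<partial>lborel)"
    by (intro nn_integral_cong nn_integral_cmult[symmetric]) measurable
  also have "\<dots> = (\<integral>\<^sup>+s. \<integral>\<^sup>+x. \<psi> x * ennreal \<bar>J s x\<bar> \<partial>lborel \<partial>lborel)"
    by (rule lborel_pair.Fubini') measurable
  also have "\<dots> \<le> (\<integral>\<^sup>+s. indicator {0<..<t} s * (\<integral>\<^sup>+y. heat_nn (t - s) \<psi> y * ennreal \<bar>F s y\<bar> \<partial>lborel) \<partial>lborel)"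
  proof (rule nn_integral_mono)
    fix s :: real
    show "(\<integral>\<^sup>+x. \<psi> x * ennreal \<bar>J s x\<bar> \<partial>lborel) \<le>
        indicator {0<..<t} s * (\<integral>\<^sup>+y. heat_nn (t - s) \<psi> y * ennreal \<bar>F s y\<bar> \<partial>lborel)"
    proof (cases "s \<in> {0<..<t}")
      case True
      then have [measurable]: "F s \<in> borel_measurable borel"
        using int[of s] borel_measurable_integrable by fastforce
      have "(\<integral>\<^sup>+x. \<psi> x * ennreal \<bar>J s x\<bar> \<partial>lborel) \<le> (\<integral>\<^sup>+x. \<psi> x * heat_nn (t - s) (\<lambda>y. ennreal \<bar>F s y\<bar>) x \<partial>lborel)"
        using True heat_abs_le[of "t - s" "F s"] by (intro nn_integral_mono mult_left_mono) (auto simp: J_def)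
      also have "\<dots> = (\<integral>\<^sup>+y. heat_nn (t - s) \<psi> y * ennreal \<bar>F s y\<bar> \<partial>lborel)"
        by (rule nn_integral_heat_nn_adjoint) measurable
      finally show ?thesis
        using True by simp
    qed (simp add: J_def)
  qed
  finally show ?thesis
    by (simp add: nn_integral_heat_nn_adjoint add_left_mono)
qed

section \<open>Gronwall's inequality and weighted bounds\<close>

text \<open>Iteration replaces differentiation: starting from the crude bound \<open>M\<close>, a
  bound of the form \<open>c * exp (2 * H s)\<close> is fed back into the integral inequality. Only
  monotonicity of the integral is applied to \<open>m\<close>, which can thus be an arbitrary
  function; an infinite \<open>a\<close> makes the claim trivial.\<close>

lemma nn_integral_gronwall:
  fixes m :: "real \<Rightarrow> ennreal" and h H :: "real \<Rightarrow> real"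
  assumes [measurable]: "h \<in> borel_measurable borel" "H \<in> borel_measurable borel"
    and deriv: "\<And>s. 0 \<le> s \<Longrightarrow> (H has_real_derivative h s) (at s)"
    and nonneg: "\<And>s. 0 \<le> s \<Longrightarrow> 0 \<le> h s" and "H 0 = 0"
    and le: "\<And>t. t \<in> {0..T} \<Longrightarrow> m t \<le> a + (\<integral>\<^sup>+s. indicator {0<..<t} s * (ennreal (h s) * m s) \<partial>lborel)"
    and bdd: "\<And>t. t \<in> {0..T} \<Longrightarrow> m t \<le> ennreal M"
    and "t \<in> {0..T}"
  shows "m t \<le> ennreal (exp (2 * H t)) * a"
proof (cases a)
  case top
  then show ?thesis
    by (simp add: ennreal_mult_top)
next
  case (real b)
  define M' where "M' = max 0 M"
  have H: "0 \<le> H t" if "0 \<le> t" for t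
    using DERIV_nonneg_imp_nondecreasing[of 0 t H] that deriv nonneg \<open>H 0 = 0\<close> by auto
  \<comment> \<open>The factor \<open>2\<close> in the exponent halves the error term in each iteration.\<close>
  have *: "m t \<le> ennreal ((b + M' / 2 ^ k) * exp (2 * H t))" if "t \<in> {0..T}" for k t
    using that
  proof (induction k arbitrary: t)
    case 0
    have "M \<le> (b + M') * exp (2 * H t)"
      using real(1) H[of t] 0 mult_left_mono[of 1 "exp (2 * H t)" "b + M'"] by (auto simp: M'_def)
    then show ?case
      using bdd[OF 0] by (simp add: order_trans[OF _ ennreal_leI])
  next
    case (Suc k)
    define c where "c = b + M' / 2 ^ k"
    have c: "0 \<le> c"
      using real(1) by (simp add: c_def M'_def)
    have t: "0 \<le> t"
      using Suc.prems by simp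
    have "m t \<le> a + (\<integral>\<^sup>+s. indicator {0<..<t} s * (ennreal (h s) * m s) \<partial>lborel)"
      by (rule le[OF Suc.prems])
    also have "(\<integral>\<^sup>+s. indicator {0<..<t} s * (ennreal (h s) * m s) \<partial>lborel) \<le>
        (\<integral>\<^sup>+s. ennreal (c * (h s * exp (2 * H s))) * indicator {0..t} s \<partial>lborel)"
    proof (rule nn_integral_mono)
      fix s
      have "ennreal (h s) * m s \<le> ennreal (c * (h s * exp (2 * H s)))" if "s \<in> {0<..<t}"
      proof -
        have "ennreal (h s) * m s \<le> ennreal (h s) * ennreal (c * exp (2 * H s))"
          using that Suc.prems unfolding c_def by (intro mult_left_mono Suc.IH) auto
        also have "\<dots> = ennreal (c * (h s * exp (2 * H s)))"
          using that c nonneg[of s] by (simp add: ennreal_mult[symmetric] mult_ac)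
        finally show ?thesis .
      qed
      then show "indicator {0<..<t} s * (ennreal (h s) * m s) \<le>
          ennreal (c * (h s * exp (2 * H s))) * indicator {0..t} s"
        by (auto simp: indicator_def)
    qed
    also have "\<dots> = ennreal (c / 2 * exp (2 * H t) - c / 2 * exp (2 * H 0))"
    proof (rule nn_integral_FTC_Icc)
      show "((\<lambda>s. c / 2 * exp (2 * H s)) has_real_derivative c * (h s * exp (2 * H s))) (at s)"
        if "s \<in> {0..t}" for s
        using that by (auto intro!: derivative_eq_intros deriv)
    qed (use c t nonneg in auto)
    also have "a + \<dots> = ennreal (b + c / 2 * (exp (2 * H t) - 1))"
    proof -
      have "0 \<le> c / 2 * (exp (2 * H t) - 1)"
        using c H[OF t] by simp
      moreover have "c / 2 * exp (2 * H t) - c / 2 * exp (2 * H 0) = c / 2 * (exp (2 * H t) - 1)"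
        using \<open>H 0 = 0\<close> by (simp add: right_diff_distrib)
      ultimately show ?thesis
        unfolding real(2) using real(1) by (simp only: ennreal_plus)
    qed
    also have "\<dots> \<le> ennreal ((b + M' / 2 ^ Suc k) * exp (2 * H t))"
    proof (rule ennreal_leI)
      \<comment> \<open>With \<open>E\<close> for the exponential and \<open>c = b + d\<close>, the
        right side minus the left side is \<open>(b * (E - 1) + d) / 2\<close>.\<close>
      have "b * 1 \<le> b * exp (2 * H t)"
        using real(1) H[OF t] by (intro mult_left_mono) auto
      moreover define d where "d = M' / 2 ^ k"
      moreover have "0 \<le> d" "M' / 2 ^ Suc k = d / 2"
        by (simp_all add: d_def M'_def)
      ultimately show "b + c / 2 * (exp (2 * H t) - 1) \<le> (b + M' / 2 ^ Suc k) * exp (2 * H t)"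
        unfolding c_def \<open>M' / 2 ^ Suc k = d / 2\<close> d_def[symmetric] by (simp add: field_simps)
    qed
    finally show ?case
      by (simp add: add_left_mono)
  qed
  have "(\<lambda>k. ennreal ((b + M' / 2 ^ k) * exp (2 * H t))) \<longlonglongrightarrow> ennreal ((b + 0) * exp (2 * H t))"
    by (intro tendsto_intros LIMSEQ_divide_realpow_zero) auto
  then have "m t \<le> ennreal ((b + 0) * exp (2 * H t))"
    by (rule LIMSEQ_le_const) (use *[OF assms(8)] in auto)
  then show ?thesis
    using real by (simp add: ennreal_mult[symmetric] mult_ac)
qed

text \<open>Gronwall's inequality needs a finite a priori bound on the weighted mass, which the
  \<open>L1\<close> bound \<open>M\<close> yields for bounded weights. General weights follow by
  truncation and monotone convergence, since the factor \<open>exp (2 * H T)\<close> does not depend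
  on the truncation level.\<close>

lemma nn_integral_duhamel_weighted_le:
  fixes u F :: "real \<Rightarrow> real ^ 'n \<Rightarrow> real" and \<psi> :: "real ^ 'n \<Rightarrow> ennreal" and h H :: "real \<Rightarrow> real"
  assumes u: "\<And>t. 0 \<le> t \<Longrightarrow> u t \<in> borel_measurable borel"
    and int: "\<And>s. 0 < s \<Longrightarrow> integrable lborel (F s)"
    and cont: "\<And>s. 0 < s \<Longrightarrow> ((\<lambda>r. \<integral>\<^sup>+y. ennreal \<bar>F r y - F s y\<bar> \<partial>lborel) \<longlongrightarrow> 0) (at s within {0<..})"
    and dom: "\<And>s. 0 < s \<Longrightarrow> AE y in lborel. \<bar>F s y\<bar> \<le> h s * \<bar>u s y\<bar>"
    and duhamel: "\<And>t. 0 \<le> t \<Longrightarrow>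
      AE x in lborel. u t x = heat t \<phi> x + (LINT s:{0..t}|lborel. heat (t - s) (F s) x)"
    and bdd: "\<And>t. 0 \<le> t \<Longrightarrow> (\<integral>\<^sup>+x. ennreal \<bar>u t x\<bar> \<partial>lborel) \<le> ennreal M"
    and [measurable]: "\<phi> \<in> borel_measurable borel" "\<psi> \<in> borel_measurable borel"
      "h \<in> borel_measurable borel" "H \<in> borel_measurable borel"
    and deriv: "\<And>s. 0 \<le> s \<Longrightarrow> (H has_real_derivative h s) (at s)"
    and nonneg: "\<And>s. 0 \<le> s \<Longrightarrow> 0 \<le> h s" and H0: "H 0 = 0"
    and T: "0 \<le> T"
  shows "(\<integral>\<^sup>+x. \<psi> x * ennreal \<bar>u T x\<bar> \<partial>lborel) \<le>
    ennreal (exp (2 * H T)) * (\<integral>\<^sup>+x. heat_nn T \<psi> x * ennreal \<bar>\<phi> x\<bar> \<partial>lborel)"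
proof -
  have bounded: "(\<integral>\<^sup>+x. \<psi>' x * ennreal \<bar>u T x\<bar> \<partial>lborel) \<le>
      ennreal (exp (2 * H T)) * (\<integral>\<^sup>+x. heat_nn T \<psi>' x * ennreal \<bar>\<phi> x\<bar> \<partial>lborel)"
    if [measurable]: "\<psi>' \<in> borel_measurable borel" and le: "\<And>x. \<psi>' x \<le> ennreal c" and "0 \<le> c" for \<psi>' c
  proof -
    define m where "m t = (\<integral>\<^sup>+y. heat_nn (T - t) \<psi>' y * ennreal \<bar>u t y\<bar> \<partial>lborel)" for t
    have "m T \<le> ennreal (exp (2 * H T)) * (\<integral>\<^sup>+x. heat_nn T \<psi>' x * ennreal \<bar>\<phi> x\<bar> \<partial>lborel)"
    proof (rule nn_integral_gronwall[where m = m and t = T and T = T and h = h and H = H and M = "c * M"])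
      fix t assume t: "t \<in> {0..T}"
      then have [measurable]: "u t \<in> borel_measurable borel"
        using u by simp
      have "m t \<le> (\<integral>\<^sup>+y. ennreal c * ennreal \<bar>u t y\<bar> \<partial>lborel)"
        unfolding m_def using t le
        by (intro nn_integral_mono mult_right_mono heat_nn_le_const) auto
      also have "\<dots> \<le> ennreal c * ennreal M"
        using t bdd[of t] by (simp add: nn_integral_cmult mult_left_mono)
      finally show "m t \<le> ennreal (c * M)"
        using \<open>0 \<le> c\<close> by (simp add: ennreal_mult')
      \<comment> \<open>Two evolutions merge into one. Taken at time \<open>t\<close> this gives the
        data term the weight \<open>heat_nn T \<psi>'\<close>; taken at time \<open>t - s\<close> it
        gives the source term the weight in \<open>m s\<close>, so the inequality closes in
        \<open>m\<close>.\<close>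
      have heat: "heat_nn s (heat_nn (T - t) \<psi>') y = heat_nn (s + (T - t)) \<psi>' y" if "0 \<le> s" for s y
        using that t by (intro heat_nn_heat_nn) auto
      have "m t = (\<integral>\<^sup>+x. heat_nn (T - t) \<psi>' x *
          ennreal \<bar>heat t \<phi> x + (LINT s:{0..t}|lborel. heat (t - s) (F s) x)\<bar> \<partial>lborel)"
        unfolding m_def using duhamel[of t] t by (intro nn_integral_cong_AE) auto
      also have "\<dots> \<le> (\<integral>\<^sup>+y. heat_nn t (heat_nn (T - t) \<psi>') y * ennreal \<bar>\<phi> y\<bar> \<partial>lborel) +
          (\<integral>\<^sup>+s. indicator {0<..<t} s *
            (\<integral>\<^sup>+y. heat_nn (t - s) (heat_nn (T - t) \<psi>') y * ennreal \<bar>F s y\<bar> \<partial>lborel) \<partial>lborel)"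
        by (rule nn_integral_duhamel_le[OF int cont]) measurable
      also have "\<dots> \<le> (\<integral>\<^sup>+y. heat_nn T \<psi>' y * ennreal \<bar>\<phi> y\<bar> \<partial>lborel) +
          (\<integral>\<^sup>+s. indicator {0<..<t} s * (ennreal (h s) * m s) \<partial>lborel)"
      proof (rule add_mono)
        show "(\<integral>\<^sup>+y. heat_nn t (heat_nn (T - t) \<psi>') y * ennreal \<bar>\<phi> y\<bar> \<partial>lborel) \<le>
            (\<integral>\<^sup>+y. heat_nn T \<psi>' y * ennreal \<bar>\<phi> y\<bar> \<partial>lborel)"
          using t heat[of t] by simp
        have *: "(\<integral>\<^sup>+y. heat_nn (t - s) (heat_nn (T - t) \<psi>') y * ennreal \<bar>F s y\<bar> \<partial>lborel) \<le> ennreal (h s) * m s"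
          if s: "0 < s" "s < t" for s
        proof -
          have [measurable]: "u s \<in> borel_measurable borel"
            using u s by simp
          have "(\<integral>\<^sup>+y. heat_nn (t - s) (heat_nn (T - t) \<psi>') y * ennreal \<bar>F s y\<bar> \<partial>lborel) \<le>
              (\<integral>\<^sup>+y. ennreal (h s) * (heat_nn (T - s) \<psi>' y * ennreal \<bar>u s y\<bar>) \<partial>lborel)"
          proof (rule nn_integral_mono_AE)
            show "AE y in lborel. heat_nn (t - s) (heat_nn (T - t) \<psi>') y * ennreal \<bar>F s y\<bar> \<le>
                ennreal (h s) * (heat_nn (T - s) \<psi>' y * ennreal \<bar>u s y\<bar>)"
              using dom[OF s(1)]
            proof eventually_elim
              case (elim y)
              have Fu: "ennreal \<bar>F s y\<bar> \<le> ennreal (h s) * ennreal \<bar>u s y\<bar>"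
                using elim nonneg[of s] s by (simp add: ennreal_mult[symmetric] ennreal_leI)
              then show ?case
                using s heat[of "t - s" y] mult_left_mono[OF Fu, of "heat_nn (T - s) \<psi>' y"]
                by (simp add: mult.left_commute)
            qed
          qed
          also have "\<dots> = ennreal (h s) * m s"
            unfolding m_def by (rule nn_integral_cmult) measurable
          finally show ?thesis .
        qed
        show "(\<integral>\<^sup>+s. indicator {0<..<t} s *
            (\<integral>\<^sup>+y. heat_nn (t - s) (heat_nn (T - t) \<psi>') y * ennreal \<bar>F s y\<bar> \<partial>lborel) \<partial>lborel) \<le>
            (\<integral>\<^sup>+s. indicator {0<..<t} s * (ennreal (h s) * m s) \<partial>lborel)"
          by (intro nn_integral_mono) (auto simp: indicator_def *)
      qed
      finally show "m t \<le> (\<integral>\<^sup>+y. heat_nn T \<psi>' y * ennreal \<bar>\<phi> y\<bar> \<partial>lborel) +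
          (\<integral>\<^sup>+s. indicator {0<..<t} s * (ennreal (h s) * m s) \<partial>lborel)" .
    qed (use assms in auto)
    then show ?thesis
      by (simp add: m_def heat_nn_def)
  qed
  have [measurable]: "u T \<in> borel_measurable borel"
    using u T by simp
  have "(SUP k. min (\<psi> x) (of_nat k)) = \<psi> x" for x
    by (simp add: inf_min[symmetric] inf_SUP[symmetric] ennreal_SUP_of_nat_eq_top)
  then have "(\<integral>\<^sup>+x. \<psi> x * ennreal \<bar>u T x\<bar> \<partial>lborel) =
      (\<integral>\<^sup>+x. (SUP k. min (\<psi> x) (of_nat k) * ennreal \<bar>u T x\<bar>) \<partial>lborel)"
    by (simp add: SUP_mult_right_ennreal[symmetric])
  also have "\<dots> = (SUP k. \<integral>\<^sup>+x. min (\<psi> x) (of_nat k) * ennreal \<bar>u T x\<bar> \<partial>lborel)"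
    by (rule nn_integral_monotone_convergence_SUP)
       (auto simp: incseq_def le_fun_def intro!: mult_right_mono min.mono)
  also have "\<dots> \<le> ennreal (exp (2 * H T)) * (\<integral>\<^sup>+x. heat_nn T \<psi> x * ennreal \<bar>\<phi> x\<bar> \<partial>lborel)"
  proof (rule SUP_least)
    fix k :: nat
    have "(\<integral>\<^sup>+x. min (\<psi> x) (of_nat k) * ennreal \<bar>u T x\<bar> \<partial>lborel) \<le>
        ennreal (exp (2 * H T)) * (\<integral>\<^sup>+x. heat_nn T (\<lambda>x. min (\<psi> x) (of_nat k)) x * ennreal \<bar>\<phi> x\<bar> \<partial>lborel)"
      by (rule bounded[where c = "real k"]) (auto simp: ennreal_of_nat_eq_real_of_nat)
    also have "\<dots> \<le> ennreal (exp (2 * H T)) * (\<integral>\<^sup>+x. heat_nn T \<psi> x * ennreal \<bar>\<phi> x\<bar> \<partial>lborel)"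
      by (intro mult_left_mono nn_integral_mono mult_right_mono heat_nn_mono) auto
    finally show "(\<integral>\<^sup>+x. min (\<psi> x) (of_nat k) * ennreal \<bar>u T x\<bar> \<partial>lborel) \<le>
        ennreal (exp (2 * H T)) * (\<integral>\<^sup>+x. heat_nn T \<psi> x * ennreal \<bar>\<phi> x\<bar> \<partial>lborel)" .
  qed
  finally show ?thesis .
qed

section \<open>Gaussian moments and tails\<close>

text \<open>Besides \<open>1 + r \<le> exp r\<close>, the square of \<open>r / 4 - k\<close> is
  nonnegative. The rate \<open>1 / 8\<close> is half of the rate \<open>1 / 4\<close> in
  \<open>heat_kernel 1\<close>, so half of the Gaussian decay survives.\<close>

lemma one_plus_power_le_exp: "0 \<le> r \<Longrightarrow> (1 + r) ^ k \<le> exp (2 * (real k)\<^sup>2) * exp (r\<^sup>2 / 8)"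
  for r :: real
proof -
  assume "0 \<le> r"
  then have "(1 + r) ^ k \<le> exp r ^ k"
    by (intro power_mono) auto
  also have "\<dots> = exp (real k * r)"
    by (simp add: exp_of_nat_mult)
  also have "real k * r \<le> 2 * (real k)\<^sup>2 + r\<^sup>2 / 8"
    using zero_le_power2[of "r / 4 - real k"] by (simp add: power2_eq_square algebra_simps)
  finally show ?thesis
    by (simp add: exp_add)
qed

text \<open>The decay that is left, with rate \<open>1 / 8\<close>, is that of
  \<open>heat_kernel 2\<close>, whose mass is one; \<open>C\<close> also corrects the ratio of the
  normalizing factors.\<close>

lemma nn_integral_heat_kernel_moment_finite:
  "(\<integral>\<^sup>+z. ennreal (heat_kernel 1 z) * ennreal ((1 + norm z) ^ k) \<partial>(lborel :: (real ^ 'n) measure)) < \<infinity>"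
proof -
  let ?d = "- real CARD('n) / 2"
  define C where "C = exp (2 * (real k)\<^sup>2) * ((4 * pi) powr ?d / (8 * pi) powr ?d)"
  have "heat_kernel 1 z * (1 + norm z) ^ k \<le> C * heat_kernel 2 z" for z :: "real ^ 'n"
  proof -
    have "heat_kernel 1 z * (1 + norm z) ^ k \<le> heat_kernel 1 z * (exp (2 * (real k)\<^sup>2) * exp ((norm z)\<^sup>2 / 8))"
      by (intro mult_left_mono one_plus_power_le_exp heat_kernel_nonneg) simp
    also have "\<dots> = exp (2 * (real k)\<^sup>2) * (4 * pi) powr ?d * (exp (- (norm z)\<^sup>2 / 4) * exp ((norm z)\<^sup>2 / 8))"
      by (simp add: heat_kernel_def)
    also have "exp (- (norm z)\<^sup>2 / 4) * exp ((norm z)\<^sup>2 / 8) = exp (- (norm z)\<^sup>2 / 8)"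
      by (simp add: exp_add[symmetric])
    finally show ?thesis
      by (simp add: heat_kernel_def C_def)
  qed
  then have "(\<integral>\<^sup>+z. ennreal (heat_kernel 1 z) * ennreal ((1 + norm z) ^ k) \<partial>(lborel :: (real ^ 'n) measure)) \<le>
      (\<integral>\<^sup>+z. ennreal C * ennreal (heat_kernel 2 z) \<partial>(lborel :: (real ^ 'n) measure))"
    by (intro nn_integral_mono) (simp add: ennreal_mult'[symmetric] ennreal_leI heat_kernel_nonneg C_def)
  also have "\<dots> = ennreal C"
    by (simp add: nn_integral_cmult nn_integral_heat_kernel)
  finally show ?thesis
    by (rule order_le_less_trans) simp
qed

text \<open>In Gaussian form \<open>norm (y + sqrt t z)\<close> is at most
  \<open>2 * max (norm y) (sqrt t) * (1 + norm z)\<close>, so its power splits into a factor in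
  \<open>y\<close> and \<open>t\<close> and a finite moment in \<open>z\<close>. The term
  \<open>sqrt t ^ m\<close> is the origin of the growth rate of the moments.\<close>

lemma heat_nn_moment_le:
  obtains C where "0 < C" "\<And>t (y :: real ^ 'n). 0 \<le> t \<Longrightarrow>
    heat_nn t (\<lambda>x. ennreal (norm x ^ m)) y \<le> ennreal (C * (norm y ^ m + sqrt t ^ m))"
proof -
  obtain G where G: "0 \<le> G"
    "(\<integral>\<^sup>+z. ennreal (heat_kernel 1 z) * ennreal ((1 + norm z) ^ m) \<partial>(lborel :: (real ^ 'n) measure)) = ennreal G"
    using nn_integral_heat_kernel_moment_finite[of m, where 'n = 'n] by (auto simp: less_top elim: ennreal_cases)
  \<comment> \<open>\<open>G + 1\<close> in place of \<open>G\<close> makes the constant strictly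
    positive.\<close>
  have "heat_nn t (\<lambda>x. ennreal (norm x ^ m)) y \<le> ennreal ((2 ^ m * (G + 1)) * (norm y ^ m + sqrt t ^ m))"
    if "0 \<le> t" for t and y :: "real ^ 'n"
  proof -
    let ?c = "2 ^ m * (norm y ^ m + sqrt t ^ m)"
    have *: "norm (y + sqrt t *\<^sub>R z) ^ m \<le> ?c * (1 + norm z) ^ m" for z
    proof -
      have "norm (y + sqrt t *\<^sub>R z) \<le> norm y + sqrt t * norm z"
        using norm_triangle_ineq[of y "sqrt t *\<^sub>R z"] that by simp
      also have "\<dots> \<le> 2 * max (norm y) (sqrt t) * (1 + norm z)"
      proof -
        define M where "M = max (norm y) (sqrt t)"
        have "norm y \<le> M" "sqrt t * norm z \<le> M * norm z" "0 \<le> M * norm z" "0 \<le> M"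
          using that by (auto intro!: mult_right_mono mult_nonneg_nonneg simp: M_def le_max_iff_disj)
        moreover have "2 * M * (1 + norm z) = 2 * M + 2 * (M * norm z)"
          by (simp add: algebra_simps)
        ultimately show ?thesis
          unfolding M_def[symmetric] by linarith
      qed
      finally have "norm (y + sqrt t *\<^sub>R z) ^ m \<le> (2 * max (norm y) (sqrt t) * (1 + norm z)) ^ m"
        by (intro power_mono) auto
      also have "\<dots> = 2 ^ m * max (norm y) (sqrt t) ^ m * (1 + norm z) ^ m"
        by (simp add: power_mult_distrib)
      also have "max (norm y) (sqrt t) ^ m \<le> norm y ^ m + sqrt t ^ m"
        using that by (simp add: max_def)
      finally show ?thesis
        by (simp add: mult_right_mono)
    qed
    have "heat_nn t (\<lambda>x. ennreal (norm x ^ m)) y =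
        (\<integral>\<^sup>+z. ennreal (heat_kernel 1 z) * ennreal (norm (y + sqrt t *\<^sub>R z) ^ m) \<partial>lborel)"
      using that by (subst heat_nn_eq_gaussian) auto
    also have "\<dots> \<le> (\<integral>\<^sup>+z. ennreal ?c * (ennreal (heat_kernel 1 z) * ennreal ((1 + norm z) ^ m)) \<partial>(lborel :: (real ^ 'n) measure))"
    proof (rule nn_integral_mono)
      fix z :: "real ^ 'n"
      have "heat_kernel 1 z * norm (y + sqrt t *\<^sub>R z) ^ m \<le> ?c * (heat_kernel 1 z * (1 + norm z) ^ m)"
        using mult_left_mono[OF *[of z] heat_kernel_nonneg[of 1 z]] by (simp add: mult_ac)
      then show "ennreal (heat_kernel 1 z) * ennreal (norm (y + sqrt t *\<^sub>R z) ^ m) \<le>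
          ennreal ?c * (ennreal (heat_kernel 1 z) * ennreal ((1 + norm z) ^ m))"
        using that by (simp add: ennreal_mult[symmetric] heat_kernel_nonneg ennreal_leI)
    qed
    also have "\<dots> = ennreal ?c * ennreal G"
      by (simp add: nn_integral_cmult G(2))
    also have "\<dots> \<le> ennreal ((2 ^ m * (G + 1)) * (norm y ^ m + sqrt t ^ m))"
      using that G(1) by (subst ennreal_mult[symmetric]) (auto intro!: ennreal_leI simp: algebra_simps)
    finally show ?thesis .
  qed
  then show ?thesis
    using G(1) by (intro that[of "2 ^ m * (G + 1)"]) auto
qed

text \<open>The weight \<open>(1 + norm x) ^ m\<close> dominates all monomials of degree at most
  \<open>m\<close> at once, so one tail controls every term of \<open>L1w_norm\<close>.\<close>

definition weight_tail :: "nat \<Rightarrow> real \<Rightarrow> real ^ 'n \<Rightarrow> ennreal" where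
  "weight_tail m R x = indicator {x. R < norm x} x * ennreal ((1 + norm x) ^ m)"

lemma weight_tail_measurable [measurable]: "weight_tail m R \<in> borel_measurable borel"
  unfolding weight_tail_def by measurable

text \<open>Uniformity in \<open>t\<close> comes from evaluating all tails under the single measure
  \<open>\<bar>\<phi> y\<bar> dy \<otimes> G\<^sub>1 z dz\<close>.\<close>

lemma heat_nn_weight_tail_uniform:
  fixes \<phi> :: "real ^ 'n \<Rightarrow> real"
  assumes [measurable]: "\<phi> \<in> borel_measurable borel"
    and fin: "(\<integral>\<^sup>+x. ennreal ((1 + norm x) ^ m) * ennreal \<bar>\<phi> x\<bar> \<partial>lborel) < \<infinity>"
    and "0 < e"
  obtains k :: nat where "\<And>t. 0 \<le> t \<Longrightarrow> t \<le> T \<Longrightarrow>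
    (\<integral>\<^sup>+y. heat_nn t (weight_tail m (real k)) y * ennreal \<bar>\<phi> y\<bar> \<partial>lborel) < e"
proof -
  \<comment> \<open>With \<open>T\<close> fixed, \<open>?W y z\<close> bounds
    \<open>norm (y + sqrt t z)\<close> for all \<open>t\<close> in \<open>{0..T}\<close>
    simultaneously; this removes \<open>t\<close> from the estimate.\<close>
  let ?W = "\<lambda>y z :: real ^ 'n. norm y + sqrt T * norm z"
  let ?M = "(lborel :: (real ^ 'n) measure) \<Otimes>\<^sub>M (lborel :: (real ^ 'n) measure)"
  define g where "g R p = (ennreal (heat_kernel 1 (snd p)) * ennreal \<bar>\<phi> (fst p)\<bar>) *
    (indicator {r. R < r} (?W (fst p) (snd p)) * ennreal ((1 + ?W (fst p) (snd p)) ^ m))" for R p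
  have [measurable]: "g R \<in> borel_measurable (borel \<Otimes>\<^sub>M borel)" for R
    unfolding g_def by measurable
  \<comment> \<open>A majorant independent of the radius and in product form: its integral factors
    into the weighted mass of \<open>\<phi>\<close> and a Gaussian moment.\<close>
  define w where "w p = (ennreal (heat_kernel 1 (snd p)) * ennreal \<bar>\<phi> (fst p)\<bar>) *
    ennreal ((1 + norm (fst p)) ^ m * ((1 + sqrt T) ^ m * (1 + norm (snd p)) ^ m))" for p :: "(real ^ 'n) \<times> (real ^ 'n)"
  have [measurable]: "w \<in> borel_measurable (borel \<Otimes>\<^sub>M borel)"
    unfolding w_def by measurable
  show ?thesis
  proof (cases "0 \<le> T")
    case False
    then show ?thesis
      by (intro that[of 0]) auto
  next
    case True
    have W: "0 \<le> ?W y z" for y z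
      using True by simp
    have "(\<lambda>k. \<integral>\<^sup>+p. g (real k) p \<partial>?M) \<longlonglongrightarrow> (\<integral>\<^sup>+p. 0 \<partial>?M)"
    proof (rule nn_integral_dominated_convergence[where M = ?M and u = "\<lambda>k. g (real k)" and w = w and u' = "\<lambda>_. 0"])
      show "AE p in ?M. g (real k) p \<le> w p" for k
      proof (rule AE_I2)
        fix p :: "(real ^ 'n) \<times> (real ^ 'n)"
        have "0 \<le> norm (fst p) * sqrt T" "0 \<le> norm (fst p) * norm (snd p)"
          "0 \<le> norm (fst p) * sqrt T * norm (snd p)" "0 \<le> norm (snd p)" "0 \<le> sqrt T"
          using True by auto
        then have "1 + ?W (fst p) (snd p) \<le> (1 + norm (fst p)) * ((1 + sqrt T) * (1 + norm (snd p)))"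
          by (simp add: algebra_simps)
        then have "(1 + ?W (fst p) (snd p)) ^ m \<le> (1 + norm (fst p)) ^ m * ((1 + sqrt T) ^ m * (1 + norm (snd p)) ^ m)"
          using W[of "fst p" "snd p"] unfolding power_mult_distrib[symmetric] by (intro power_mono) linarith+
        then show "g (real k) p \<le> w p"
          unfolding g_def w_def by (intro mult_left_mono) (auto simp: indicator_def intro: ennreal_leI)
      qed
      have w_eq: "w (y, z) = ennreal ((1 + sqrt T) ^ m) * ((ennreal ((1 + norm y) ^ m) * ennreal \<bar>\<phi> y\<bar>) *
          (ennreal (heat_kernel 1 z) * ennreal ((1 + norm z) ^ m)))" for y z
        using True by (simp add: w_def ennreal_mult mult_ac)
      have "(\<integral>\<^sup>+p. w p \<partial>?M) = (\<integral>\<^sup>+y. \<integral>\<^sup>+z. w (y, z) \<partial>lborel \<partial>lborel)"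
        by (rule lborel.nn_integral_fst[symmetric]) measurable
      also have "\<dots> = (\<integral>\<^sup>+y. \<integral>\<^sup>+z. ennreal ((1 + sqrt T) ^ m) * ((ennreal ((1 + norm y) ^ m) * ennreal \<bar>\<phi> y\<bar>) *
          (ennreal (heat_kernel 1 z) * ennreal ((1 + norm z) ^ m))) \<partial>(lborel :: (real ^ 'n) measure) \<partial>lborel)"
        by (simp only: w_eq)
      also have "\<dots> = ennreal ((1 + sqrt T) ^ m) *
          ((\<integral>\<^sup>+y. ennreal ((1 + norm y) ^ m) * ennreal \<bar>\<phi> y\<bar> \<partial>lborel) *
          (\<integral>\<^sup>+z. ennreal (heat_kernel 1 z) * ennreal ((1 + norm z) ^ m) \<partial>(lborel :: (real ^ 'n) measure)))"
        by (simp add: nn_integral_cmult nn_integral_multc)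
      also have "\<dots> < \<infinity>"
        using fin nn_integral_heat_kernel_moment_finite[of m, where 'n = 'n]
        by (simp add: ennreal_mult_less_top less_top)
      finally show "(\<integral>\<^sup>+p. w p \<partial>?M) < \<infinity>" .
      show "AE p in ?M. (\<lambda>k. g (real k) p) \<longlonglongrightarrow> 0"
      proof (rule AE_I2)
        fix p :: "(real ^ 'n) \<times> (real ^ 'n)"
        \<comment> \<open>For fixed \<open>p\<close> the cutoff vanishes once the radius reaches
          \<open>?W\<close>, so the sequence is eventually equal to 0.\<close>
        obtain N :: nat where "?W (fst p) (snd p) \<le> real N"
          using real_arch_simple by blast
        then have "g (real k) p = 0" if "N \<le> k" for k
          using that by (simp add: g_def indicator_def)
        then show "(\<lambda>k. g (real k) p) \<longlonglongrightarrow> 0"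
          by (intro tendsto_eventually) (auto simp: eventually_sequentially)
      qed
    qed measurable
    then have "eventually (\<lambda>k. (\<integral>\<^sup>+p. g (real k) p \<partial>?M) < e) sequentially"
      using \<open>0 < e\<close> by (auto dest: order_tendstoD)
    then obtain k where k: "(\<integral>\<^sup>+p. g (real k) p \<partial>?M) < e"
      by (auto simp: eventually_sequentially)
    have "(\<integral>\<^sup>+y. heat_nn t (weight_tail m (real k)) y * ennreal \<bar>\<phi> y\<bar> \<partial>lborel) < e" if t: "0 \<le> t" "t \<le> T" for t
    proof -
      have tail: "weight_tail m (real k) (y + sqrt t *\<^sub>R z) \<le>
          indicator {r. real k < r} (?W y z) * ennreal ((1 + ?W y z) ^ m)" for y z :: "real ^ 'n"
      proof -
        have "norm (y + sqrt t *\<^sub>R z) \<le> norm y + norm (sqrt t *\<^sub>R z)"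
          by (rule norm_triangle_ineq)
        also have "\<dots> \<le> ?W y z"
          using t by (auto intro!: mult_right_mono)
        finally have "norm (y + sqrt t *\<^sub>R z) \<le> ?W y z" .
        then show ?thesis
          by (auto simp: weight_tail_def indicator_def intro!: ennreal_leI power_mono)
      qed
      have "(\<integral>\<^sup>+y. heat_nn t (weight_tail m (real k)) y * ennreal \<bar>\<phi> y\<bar> \<partial>lborel) =
          (\<integral>\<^sup>+y. \<integral>\<^sup>+z. (ennreal (heat_kernel 1 z) * ennreal \<bar>\<phi> y\<bar>) * weight_tail m (real k) (y + sqrt t *\<^sub>R z) \<partial>lborel \<partial>lborel)"
      proof (rule nn_integral_cong)
        fix y :: "real ^ 'n"
        have "heat_nn t (weight_tail m (real k)) y * ennreal \<bar>\<phi> y\<bar> =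
            (\<integral>\<^sup>+z. (ennreal (heat_kernel 1 z) * weight_tail m (real k) (y + sqrt t *\<^sub>R z)) * ennreal \<bar>\<phi> y\<bar> \<partial>lborel)"
          using t by (subst nn_integral_multc) (simp_all add: heat_nn_eq_gaussian)
        then show "heat_nn t (weight_tail m (real k)) y * ennreal \<bar>\<phi> y\<bar> =
            (\<integral>\<^sup>+z. (ennreal (heat_kernel 1 z) * ennreal \<bar>\<phi> y\<bar>) * weight_tail m (real k) (y + sqrt t *\<^sub>R z) \<partial>lborel)"
          by (simp add: mult_ac)
      qed
      also have "\<dots> \<le> (\<integral>\<^sup>+y. \<integral>\<^sup>+z. g (real k) (y, z) \<partial>lborel \<partial>lborel)"
        unfolding g_def fst_conv snd_conv by (intro nn_integral_mono mult_left_mono tail) simp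
      also have "\<dots> = (\<integral>\<^sup>+p. g (real k) p \<partial>?M)"
        by (rule lborel.nn_integral_fst) measurable
      finally show ?thesis
        using k by simp
    qed
    then show ?thesis
      by (rule that)
  qed
qed

section \<open>Norms, weights and the nonlinearity\<close>

lemma Lq_norm_1: "Lq_norm 1 g = (\<integral>\<^sup>+x. ennreal \<bar>g x\<bar> \<partial>lborel)"
proof -
  have "ennreal (enn2real I powr 1) = I" if "I \<noteq> \<infinity>" for I
    using that by (simp add: less_top)
  then show ?thesis
    by (simp add: Lq_norm_def Let_def)
qed

lemma Lq_norm_inf_AE: "Lq_norm \<infinity> g \<le> ennreal c \<Longrightarrow> 0 \<le> c \<Longrightarrow> AE x in lborel. \<bar>g x\<bar> \<le> c"
  using esssup_AE[of "\<lambda>x. ennreal \<bar>g x\<bar>" lborel]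
  by (auto simp: Lq_norm_def elim!: eventually_mono dest: order_trans)

lemma Lq_1_integrable: "g \<in> Lq 1 \<longleftrightarrow> integrable lborel g"
  by (auto simp: Lq_def Lq_norm_1 integrable_iff_bounded)

lemma abs_mi_power_le: "\<bar>mi_power x \<alpha>\<bar> \<le> norm x ^ mi_length \<alpha>"
proof -
  have "\<bar>mi_power x \<alpha>\<bar> = (\<Prod>i\<in>UNIV. \<bar>x $ i\<bar> ^ \<alpha> i)"
    by (simp add: mi_power_def abs_prod power_abs)
  also have "\<dots> \<le> (\<Prod>i\<in>UNIV. norm x ^ \<alpha> i)"
    by (intro prod_mono conjI power_mono component_le_norm_cart) auto
  also have "\<dots> = norm x ^ mi_length \<alpha>"
    by (simp add: mi_length_def power_sum)
  finally show ?thesis .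
qed

lemma mi_power_measurable [measurable]: "(\<lambda>x. mi_power x \<alpha>) \<in> borel_measurable borel"
  unfolding mi_power_def by (intro borel_measurable_continuous_onI continuous_intros)

text \<open>The constant 1 and the pure powers of the coordinates already control the full weight:
  with \<open>M\<close> the maximum of 1 and all coordinate moduli, \<open>1 + norm x\<close> is at
  most \<open>(1 + n) * M\<close>, and \<open>M ^ m\<close> is one of the summands on the
  right.\<close>

lemma one_plus_norm_power_le:
  fixes x :: "real ^ 'n"
  shows "(1 + norm x) ^ m \<le> (1 + real CARD('n)) ^ m * (1 + (\<Sum>i\<in>UNIV. \<bar>x $ i\<bar> ^ m))"
proof -
  define M where "M = Max (insert 1 (range (\<lambda>i. \<bar>x $ i\<bar>)))"
  have M: "1 \<le> M" "\<bar>x $ i\<bar> \<le> M" for i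
    unfolding M_def by (rule Max_ge; simp)+
  have "norm x \<le> (\<Sum>i\<in>UNIV. \<bar>x $ i\<bar>)"
    by (rule norm_le_l1_cart)
  also have "\<dots> \<le> real CARD('n) * M"
    using sum_bounded_above[of UNIV "\<lambda>i. \<bar>x $ i\<bar>" M] M by simp
  finally have "(1 + norm x) ^ m \<le> ((1 + real CARD('n)) * M) ^ m"
    using M(1) by (intro power_mono) (auto simp: algebra_simps)
  moreover have "M ^ m \<le> 1 + (\<Sum>i\<in>UNIV. \<bar>x $ i\<bar> ^ m)"
  proof -
    have nn: "0 \<le> (\<Sum>i\<in>UNIV. \<bar>x $ i\<bar> ^ m)"
      by (intro sum_nonneg) auto
    have "M \<in> insert 1 (range (\<lambda>i. \<bar>x $ i\<bar>))"
      unfolding M_def by (rule Max_in) auto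
    then show ?thesis
    proof
      assume "M = 1"
      then show ?thesis
        using nn by simp
    next
      assume "M \<in> range (\<lambda>i. \<bar>x $ i\<bar>)"
      then obtain i where "M = \<bar>x $ i\<bar>"
        by auto
      then show ?thesis
        using member_le_sum[of i UNIV "\<lambda>i. \<bar>x $ i\<bar> ^ m"] by auto
    qed
  qed
  ultimately show ?thesis
    by (smt (verit, best) mult_left_mono of_nat_0_le_iff power_mult_distrib zero_le_power)
qed

lemma L1w_weight_finite:
  fixes g :: "real ^ 'n \<Rightarrow> real"
  assumes "g \<in> L1w m"
  shows "(\<integral>\<^sup>+x. ennreal ((1 + norm x) ^ m) * ennreal \<bar>g x\<bar> \<partial>lborel) < \<infinity>"
proof -
  have int0: "integrable lborel g"
    using assms by (simp add: L1w_def Lq_1_integrable)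
  have int: "integrable lborel (\<lambda>x. x $ i ^ m * g x)" for i
  proof -
    define \<alpha> where "\<alpha> = (\<lambda>j. if j = i then m else 0)"
    have "mi_length \<alpha> = m" "mi_power x \<alpha> = x $ i ^ m" for x :: "real ^ 'n"
      by (simp_all add: \<alpha>_def mi_length_def mi_power_def if_distrib cong: if_cong)
    then show ?thesis
      using assms by (auto simp: L1w_def Lq_1_integrable)
  qed
  let ?S = "\<lambda>x. \<bar>g x\<bar> + (\<Sum>i\<in>UNIV. \<bar>x $ i ^ m * g x\<bar>)"
  have "integrable lborel ?S"
    using int0 int by (intro Bochner_Integration.integrable_add Bochner_Integration.integrable_sum integrable_abs) auto
  then have "integrable lborel (\<lambda>x. (1 + real CARD('n)) ^ m * ?S x)"
    by simp
  then have "(\<integral>\<^sup>+x. ennreal (norm ((1 + real CARD('n)) ^ m * ?S x)) \<partial>lborel) < \<infinity>"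
    unfolding integrable_iff_bounded by blast
  moreover have "(\<integral>\<^sup>+x. ennreal ((1 + norm x) ^ m) * ennreal \<bar>g x\<bar> \<partial>lborel) \<le>
      (\<integral>\<^sup>+x. ennreal (norm ((1 + real CARD('n)) ^ m * ?S x)) \<partial>lborel)"
  proof (rule nn_integral_mono)
    fix x :: "real ^ 'n"
    have "(1 + norm x) ^ m * \<bar>g x\<bar> \<le> (1 + real CARD('n)) ^ m * (1 + (\<Sum>i\<in>UNIV. \<bar>x $ i\<bar> ^ m)) * \<bar>g x\<bar>"
      by (intro mult_right_mono one_plus_norm_power_le) simp
    also have "\<dots> = (1 + real CARD('n)) ^ m * ?S x"
      by (simp add: algebra_simps sum_distrib_left sum_distrib_right abs_mult power_abs)
    also have "\<dots> \<le> norm ((1 + real CARD('n)) ^ m * ?S x)"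
      by simp
    finally show "ennreal ((1 + norm x) ^ m) * ennreal \<bar>g x\<bar> \<le> ennreal (norm ((1 + real CARD('n)) ^ m * ?S x))"
      by (subst ennreal_mult[symmetric]) (auto intro!: ennreal_leI)
  qed
  ultimately show ?thesis
    by simp
qed

lemma Lq_norm_1_mi_power_le:
  assumes "mi_length \<alpha> \<le> m"
  shows "Lq_norm 1 (\<lambda>x. mi_power x \<alpha> * g x) \<le> (\<integral>\<^sup>+x. ennreal ((1 + norm x) ^ m) * ennreal \<bar>g x\<bar> \<partial>lborel)"
  unfolding Lq_norm_1
proof (rule nn_integral_mono)
  fix x
  have "\<bar>mi_power x \<alpha>\<bar> \<le> norm x ^ mi_length \<alpha>"
    by (rule abs_mi_power_le)
  also have "\<dots> \<le> (1 + norm x) ^ mi_length \<alpha>"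
    by (intro power_mono) auto
  also have "\<dots> \<le> (1 + norm x) ^ m"
    using assms by (intro power_increasing) auto
  finally show "ennreal \<bar>mi_power x \<alpha> * g x\<bar> \<le> ennreal ((1 + norm x) ^ m) * ennreal \<bar>g x\<bar>"
    by (subst ennreal_mult[symmetric]) (auto intro!: ennreal_leI mult_right_mono simp: abs_mult)
qed

lemma L1w_norm_le:
  "L1w_norm m g \<le> of_nat (card {\<alpha> :: 'n \<Rightarrow> nat. mi_length \<alpha> \<le> m}) *
    (\<integral>\<^sup>+x. ennreal ((1 + norm x) ^ m) * ennreal \<bar>g x\<bar> \<partial>(lborel :: (real ^ 'n) measure))"
  unfolding L1w_norm_def by (intro sum_bounded_above Lq_norm_1_mi_power_le) auto

lemma L1w_I:
  fixes g :: "real ^ 'n \<Rightarrow> real"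
  assumes [measurable]: "g \<in> borel_measurable borel"
    and fin: "(\<integral>\<^sup>+x. ennreal ((1 + norm x) ^ m) * ennreal \<bar>g x\<bar> \<partial>lborel) < \<infinity>"
  shows "g \<in> L1w m"
proof -
  have "Lq_norm 1 (\<lambda>x. mi_power x \<alpha> * g x) < \<infinity>" if "mi_length \<alpha> \<le> m" for \<alpha>
    using Lq_norm_1_mi_power_le[OF that] fin by (rule order_le_less_trans)
  then have *: "(\<lambda>x. mi_power x \<alpha> * g x) \<in> Lq 1" if "mi_length \<alpha> \<le> m" for \<alpha>
    using that by (simp add: Lq_def)
  show ?thesis
    \<comment> \<open>The zero multi-index yields membership of \<open>g\<close> itself in
      \<open>Lq 1\<close>.\<close>
    using * *[of "\<lambda>_. 0"] by (simp add: L1w_def mi_length_def mi_power_def)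
qed

section \<open>Lipschitz bounds and continuity of the nonlinearity\<close>

lemma nonlinearity_lipschitz:
  assumes "nonlinearity f K p" "0 < K" "1 < p" "\<bar>\<xi>\<bar> \<le> a" "\<bar>\<eta>\<bar> \<le> a"
  shows "\<bar>f \<xi> - f \<eta>\<bar> \<le> 2 * K * a powr (p - 1) * \<bar>\<xi> - \<eta>\<bar>"
proof -
  have "\<bar>f \<xi> - f \<eta>\<bar> \<le> K * (\<bar>\<xi>\<bar> powr (p - 1) + \<bar>\<eta>\<bar> powr (p - 1)) * \<bar>\<xi> - \<eta>\<bar>"
    using assms by (simp add: nonlinearity_def)
  also have "\<dots> \<le> K * (a powr (p - 1) + a powr (p - 1)) * \<bar>\<xi> - \<eta>\<bar>"
    using assms by (intro mult_right_mono mult_left_mono add_mono powr_mono2) auto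
  finally show ?thesis
    by simp
qed

lemma nonlinearity_abs_le:
  assumes "nonlinearity f K p" "0 < K" "1 < p" "\<bar>\<xi>\<bar> \<le> a"
  shows "\<bar>f \<xi>\<bar> \<le> K * a powr (p - 1) * \<bar>\<xi>\<bar>"
proof -
  have "\<bar>f \<xi> - f 0\<bar> \<le> K * (\<bar>\<xi>\<bar> powr (p - 1) + \<bar>0\<bar> powr (p - 1)) * \<bar>\<xi> - 0\<bar>" "f 0 = 0"
    using assms(1) unfolding nonlinearity_def by blast+
  then have "\<bar>f \<xi>\<bar> \<le> K * \<bar>\<xi>\<bar> powr (p - 1) * \<bar>\<xi>\<bar>"
    by simp
  also have "\<dots> \<le> K * a powr (p - 1) * \<bar>\<xi>\<bar>"
    using assms by (intro mult_right_mono mult_left_mono powr_mono2) auto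
  finally show ?thesis .
qed

text \<open>\<open>f\<close> is Lipschitz on bounded intervals. Continuity is wanted because it
  makes \<open>f\<close> Borel, and hence \<open>f (u s y)\<close> measurable in
  \<open>y\<close>.\<close>

lemma nonlinearity_continuous:
  assumes "nonlinearity f K p" "0 < K" "1 < p"
  shows "continuous_on UNIV f"
proof -
  have "isCont f x" for x
  proof -
    define L where "L = 2 * K * (\<bar>x\<bar> + 1) powr (p - 1)"
    have "(f \<longlongrightarrow> f x) (at x)"
    proof (rule LIM_zero_cancel, rule Lim_null_comparison)
      have "eventually (\<lambda>y. dist y x < 1) (at x)"
        using eventually_at by (metis zero_less_one)
      then show "eventually (\<lambda>y. norm (f y - f x) \<le> L * \<bar>y - x\<bar>) (at x)"
      proof eventually_elim
        case (elim y)
        then show ?case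
          using nonlinearity_lipschitz[OF assms, of y "\<bar>x\<bar> + 1" x] by (simp add: L_def dist_real_def)
      qed
      show "((\<lambda>y. L * \<bar>y - x\<bar>) \<longlongrightarrow> 0) (at x)"
        by (auto intro!: tendsto_eq_intros)
    qed
    then show ?thesis
      by (simp add: isCont_def)
  qed
  then show ?thesis
    by (simp add: continuous_at_imp_continuous_on)
qed

text \<open>The bound comes from the index \<open>q = \<infinity>\<close> of the double supremum,
  where \<open>inverse \<infinity> = 0\<close> turns the exponent into \<open>n / 2\<close>.\<close>

lemma decaying_sup_bound:
  fixes v :: "real \<Rightarrow> real ^ 'n \<Rightarrow> real"
  assumes "decaying v"
  obtains A where "0 < A"
    "\<And>t. 0 \<le> t \<Longrightarrow> AE x in lborel. \<bar>v t x\<bar> \<le> A * (1 + t) powr (- real CARD('n) / 2)"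
proof -
  define S where "S = (SUP t\<in>{0..}. ennreal ((1 + t) powr (real CARD('n) / 2)) * Lq_norm \<infinity> (v t))"
  have "S \<le> (SUP q\<in>{1..}. SUP t\<in>{0..}.
      ennreal ((1 + t) powr (real CARD('n) / 2 * (1 - enn2real (inverse q)))) * Lq_norm q (v t))"
    unfolding S_def by (rule SUP_upper2[of \<infinity>]) auto
  also have "\<dots> < \<infinity>"
    using assms unfolding decaying_def .
  finally obtain B where B: "0 \<le> B" "S = ennreal B"
    by (auto simp: less_top elim: ennreal_cases)
  \<comment> \<open>The supremum \<open>B\<close> may be 0, while \<open>A\<close> has to be
    positive.\<close>
  define A where "A = B + 1"
  have "AE x in lborel. \<bar>v t x\<bar> \<le> A * (1 + t) powr (- real CARD('n) / 2)" if t: "0 \<le> t" for t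
  proof (rule Lq_norm_inf_AE)
    define w where "w = (1 + t) powr (real CARD('n) / 2)"
    have w: "0 < w" "(1 + t) powr (- real CARD('n) / 2) = 1 / w"
      using t by (simp_all add: w_def powr_minus_divide)
    have "ennreal w * Lq_norm \<infinity> (v t) \<le> S"
      unfolding S_def w_def using t by (intro SUP_upper) auto
    also have "S \<le> ennreal A"
      using B by (simp add: A_def ennreal_leI del: ennreal_plus)
    finally have "ennreal (1 / w) * (ennreal w * Lq_norm \<infinity> (v t)) \<le> ennreal (1 / w) * ennreal A"
      by (rule mult_left_mono) simp
    then show "Lq_norm \<infinity> (v t) \<le> ennreal (A * (1 + t) powr (- real CARD('n) / 2))"
      unfolding w(2) using w(1) B(1) by (simp add: mult.assoc[symmetric] ennreal_mult[symmetric] A_def del: ennreal_plus)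
  qed (use B(1) in \<open>simp add: A_def\<close>)
  then show ?thesis
    using B(1) by (intro that[of A]) (auto simp: A_def)
qed

section \<open>Solutions with weighted data\<close>

text \<open>The primitive is normalized to vanish at time 0. For \<open>g > 1\<close> and
  \<open>c \<ge> 0\<close> it stays below \<open>c / (g - 1)\<close>, which makes the Gronwall
  factor uniform in time.\<close>

lemma one_plus_powr_antiderivative:
  assumes "g \<noteq> (1 :: real)" "0 \<le> s"
  shows "((\<lambda>s. c / (g - 1) * (1 - (1 + s) powr (1 - g))) has_real_derivative c * (1 + s) powr (- g)) (at s)"
proof -
  have "((\<lambda>s. (1 + s) powr (1 - g)) has_real_derivative (1 - g) * (1 + s) powr (1 - g - 1)) (at s)"
    using assms(2) DERIV_fun_powr[of "\<lambda>s. 1 + s" 1 s "1 - g"] by (auto intro!: derivative_eq_intros)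
  from DERIV_cmult[OF DERIV_diff[OF DERIV_const this], of "c / (g - 1)" 1]
  show ?thesis
    by (rule DERIV_cong) (use assms(1) in \<open>simp add: field_simps\<close>)
qed

lemma solution_weighted_le:
  fixes \<phi> :: "real ^ 'n \<Rightarrow> real" and u :: "real \<Rightarrow> real ^ 'n \<Rightarrow> real"
  assumes p: "p > 1 + 2 / real CARD('n)" and K: "K > 0" and f: "nonlinearity f K p"
    and A: "0 < A" "\<And>t. 0 \<le> t \<Longrightarrow> AE x in lborel. \<bar>u t x\<bar> \<le> A * (1 + t) powr (- real CARD('n) / 2)"
    and \<phi>: "\<phi> \<in> Lq 1" and u: "global_solution f \<phi> u"
  obtains B where "0 < B" "\<And>t \<psi>. 0 \<le> t \<Longrightarrow> \<psi> \<in> borel_measurable borel \<Longrightarrow>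
    (\<integral>\<^sup>+x. \<psi> x * ennreal \<bar>u t x\<bar> \<partial>lborel) \<le> ennreal B * (\<integral>\<^sup>+x. heat_nn t \<psi> x * ennreal \<bar>\<phi> x\<bar> \<partial>lborel)"
proof -
  \<comment> \<open>The condition on \<open>p\<close> is equivalent to \<open>1 < \<gamma>\<close>,
    that is, to integrability of the function \<open>h\<close> below over all positive
    times.\<close>
  define \<gamma> where "\<gamma> = real CARD('n) / 2 * (p - 1)"
  have "2 / real CARD('n) < p - 1"
    using p by simp
  then have \<gamma>: "1 < \<gamma>"
    by (simp add: \<gamma>_def field_simps)
  have "0 < 2 / real CARD('n)"
    by simp
  then have p1: "1 < p"
    using p by linarith
  define c where "c = K * A powr (p - 1)"
  have c: "0 < c"
    using K A(1) by (simp add: c_def)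
  define h where "h s = c * (1 + s) powr (- \<gamma>)" for s
  define H where "H s = c / (\<gamma> - 1) * (1 - (1 + s) powr (1 - \<gamma>))" for s
  have X: "u \<in> X_space"
    using u by (simp add: global_solution_def)
  have uint: "integrable lborel (u t)" if "0 \<le> t" for t
    using X that by (auto simp: X_space_def continuous_into_def Lq_1_integrable)
  then have umeas: "u t \<in> borel_measurable borel" if "0 \<le> t" for t
    using borel_measurable_integrable[OF uint[OF that]] by simp
  have [measurable]: "f \<in> borel_measurable borel"
    by (rule borel_measurable_continuous_onI[OF nonlinearity_continuous[OF f K p1]])
  have dom: "AE y in lborel. \<bar>f (u s y)\<bar> \<le> h s * \<bar>u s y\<bar>" if "0 \<le> s" for s
    using A(2)[OF that]
  proof eventually_elim
    case (elim y)
    have "K * (A * (1 + s) powr (- real CARD('n) / 2)) powr (p - 1) = h s"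
      using A(1) that by (simp add: h_def c_def powr_mult powr_powr \<gamma>_def)
    then show ?case
      using nonlinearity_abs_le[OF f K p1 elim] by simp
  qed
  \<comment> \<open>A bound uniform in time gives one Lipschitz constant for \<open>f\<close> on all
    values of \<open>u\<close>; this transfers continuity in \<open>L1\<close> from \<open>u\<close>
    to \<open>f (u s)\<close>.\<close>
  have Ale: "AE x in lborel. \<bar>u t x\<bar> \<le> A" if "0 \<le> t" for t
    using A(2)[OF that]
  proof eventually_elim
    case (elim x)
    have "(1 + t) powr (- real CARD('n) / 2) \<le> (1 + t) powr 0"
      using that by (intro powr_mono) auto
    also have "\<dots> = 1"
      using that by simp
    finally have "A * (1 + t) powr (- real CARD('n) / 2) \<le> A * 1"
      using A(1) by (intro mult_left_mono) auto
    then show ?case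
      using elim by linarith
  qed
  have int: "integrable lborel (\<lambda>y. f (u s y))" if "0 < s" for s
  proof (rule Bochner_Integration.integrable_bound)
    show "integrable lborel (\<lambda>y. h s * u s y)"
      using uint[of s] that by simp
    show "(\<lambda>y. f (u s y)) \<in> borel_measurable lborel"
      using umeas[of s] that by simp
    have "0 \<le> h s"
      using c by (simp add: h_def)
    then show "AE y in lborel. norm (f (u s y)) \<le> norm (h s * u s y)"
      using dom[of s] that by (simp add: abs_mult)
  qed
  have cont: "((\<lambda>r. \<integral>\<^sup>+y. ennreal \<bar>f (u r y) - f (u s y)\<bar> \<partial>lborel) \<longlongrightarrow> 0) (at s within {0<..})" if s: "0 < s" for s
  proof (rule tendsto_sandwich[OF _ _ tendsto_const])
    let ?L = "2 * K * A powr (p - 1)"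
    have "((\<lambda>r. \<integral>\<^sup>+y. ennreal \<bar>u r y - u s y\<bar> \<partial>lborel) \<longlongrightarrow> 0) (at s within {0..})"
      using X s by (auto simp: X_space_def continuous_into_def Lq_norm_1)
    then have "((\<lambda>r. \<integral>\<^sup>+y. ennreal \<bar>u r y - u s y\<bar> \<partial>lborel) \<longlongrightarrow> 0) (at s within {0<..})"
      by (rule tendsto_within_subset) auto
    from tendsto_mult_ennreal[OF tendsto_const this, of "ennreal ?L"]
    show "((\<lambda>r. ennreal ?L * (\<integral>\<^sup>+y. ennreal \<bar>u r y - u s y\<bar> \<partial>lborel)) \<longlongrightarrow> 0) (at s within {0<..})"
      by simp
    have "(\<integral>\<^sup>+y. ennreal \<bar>f (u r y) - f (u s y)\<bar> \<partial>lborel) \<le> ennreal ?L * (\<integral>\<^sup>+y. ennreal \<bar>u r y - u s y\<bar> \<partial>lborel)"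
      if r: "0 < r" for r
    proof -
      have "(\<integral>\<^sup>+y. ennreal \<bar>f (u r y) - f (u s y)\<bar> \<partial>lborel) \<le> (\<integral>\<^sup>+y. ennreal ?L * ennreal \<bar>u r y - u s y\<bar> \<partial>lborel)"
      proof (rule nn_integral_mono_AE)
        show "AE y in lborel. ennreal \<bar>f (u r y) - f (u s y)\<bar> \<le> ennreal ?L * ennreal \<bar>u r y - u s y\<bar>"
          using Ale[OF less_imp_le[OF r]] Ale[OF less_imp_le[OF s]]
        proof eventually_elim
          case (elim y)
          then show ?case
            using nonlinearity_lipschitz[OF f K p1 elim] K by (simp add: ennreal_mult[symmetric] ennreal_leI)
        qed
      qed
      also have "\<dots> = ennreal ?L * (\<integral>\<^sup>+y. ennreal \<bar>u r y - u s y\<bar> \<partial>lborel)"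
        using umeas[of r] umeas[of s] r s by (intro nn_integral_cmult) auto
      finally show ?thesis .
    qed
    then show "\<forall>\<^sub>F r in at s within {0<..}. (\<integral>\<^sup>+y. ennreal \<bar>f (u r y) - f (u s y)\<bar> \<partial>lborel) \<le>
        ennreal ?L * (\<integral>\<^sup>+y. ennreal \<bar>u r y - u s y\<bar> \<partial>lborel)"
      by (auto simp: eventually_at_filter)
  qed simp
  have "(SUP t\<in>{0..}. \<integral>\<^sup>+x. ennreal \<bar>u t x\<bar> \<partial>lborel) < \<infinity>"
    using X by (simp add: X_space_def bounded_into_def Lq_norm_1)
  then obtain M where M: "(SUP t\<in>{0..}. \<integral>\<^sup>+x. ennreal \<bar>u t x\<bar> \<partial>lborel) = ennreal M"
    by (cases "SUP t\<in>{0..}. \<integral>\<^sup>+x. ennreal \<bar>u t x\<bar> \<partial>lborel") auto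
  have bdd: "(\<integral>\<^sup>+x. ennreal \<bar>u t x\<bar> \<partial>lborel) \<le> ennreal M" if "0 \<le> t" for t
    unfolding M[symmetric] using that by (intro SUP_upper) auto
  have [measurable]: "\<phi> \<in> borel_measurable borel"
    using \<phi> by (simp add: Lq_def)
  \<comment> \<open>\<open>c / (\<gamma> - 1)\<close> is the integral of \<open>h\<close> over all
    positive times, so one factor serves every \<open>t\<close>.\<close>
  define B where "B = exp (2 * (c / (\<gamma> - 1)))"
  have "(\<integral>\<^sup>+x. \<psi> x * ennreal \<bar>u t x\<bar> \<partial>lborel) \<le> ennreal B * (\<integral>\<^sup>+x. heat_nn t \<psi> x * ennreal \<bar>\<phi> x\<bar> \<partial>lborel)"
    if t: "0 \<le> t" and [measurable]: "\<psi> \<in> borel_measurable borel" for t \<psi>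
  proof -
    have "(\<integral>\<^sup>+x. \<psi> x * ennreal \<bar>u t x\<bar> \<partial>lborel) \<le>
        ennreal (exp (2 * H t)) * (\<integral>\<^sup>+x. heat_nn t \<psi> x * ennreal \<bar>\<phi> x\<bar> \<partial>lborel)"
    proof (rule nn_integral_duhamel_weighted_le[where h = h and F = "\<lambda>s y. f (u s y)" and M = M])
      show "AE x in lborel. u t x = heat t \<phi> x + (LINT s:{0..t}|lborel. heat (t - s) (\<lambda>y. f (u s y)) x)"
        if "0 \<le> t" for t
        using u that unfolding global_solution_def by (auto elim: eventually_mono)
      show "(H has_real_derivative h s) (at s)" if "0 \<le> s" for s
        unfolding H_def h_def using \<gamma> that by (intro one_plus_powr_antiderivative) auto
      show "0 \<le> h s" for s
        using c by (simp add: h_def)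
      show "h \<in> borel_measurable borel" "H \<in> borel_measurable borel"
        unfolding h_def H_def by measurable
    qed (use umeas int cont dom bdd t in \<open>auto simp: H_def\<close>)
    also have "\<dots> \<le> ennreal B * (\<integral>\<^sup>+x. heat_nn t \<psi> x * ennreal \<bar>\<phi> x\<bar> \<partial>lborel)"
    proof (intro mult_right_mono ennreal_leI)
      have "H t \<le> c / (\<gamma> - 1) * 1"
        unfolding H_def using c \<gamma> by (intro mult_left_mono) auto
      then show "exp (2 * H t) \<le> B"
        by (simp add: B_def)
    qed simp
    finally show ?thesis .
  qed
  then show ?thesis
    by (intro that[of B]) (simp_all add: B_def)
qed

section \<open>Continuity and moment growth in the weighted space\<close>

lemma nn_integral_weight_split:
  assumes [measurable]: "g \<in> borel_measurable borel" and "0 \<le> R"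
  shows "(\<integral>\<^sup>+x. ennreal ((1 + norm x) ^ m) * ennreal \<bar>g x\<bar> \<partial>(lborel :: (real ^ 'n) measure)) \<le>
    ennreal ((1 + R) ^ m) * (\<integral>\<^sup>+x. ennreal \<bar>g x\<bar> \<partial>lborel) + (\<integral>\<^sup>+x. weight_tail m R x * ennreal \<bar>g x\<bar> \<partial>lborel)"
proof -
  have "(\<integral>\<^sup>+x. ennreal ((1 + norm x) ^ m) * ennreal \<bar>g x\<bar> \<partial>(lborel :: (real ^ 'n) measure)) \<le>
      (\<integral>\<^sup>+x. ennreal ((1 + R) ^ m) * ennreal \<bar>g x\<bar> + weight_tail m R x * ennreal \<bar>g x\<bar> \<partial>lborel)"
  proof (rule nn_integral_mono)
    fix x :: "real ^ 'n"
    have "ennreal ((1 + norm x) ^ m) \<le> ennreal ((1 + R) ^ m) + weight_tail m R x"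
      by (cases "norm x \<le> R") (auto simp: weight_tail_def intro!: ennreal_leI power_mono)
    then show "ennreal ((1 + norm x) ^ m) * ennreal \<bar>g x\<bar> \<le>
        ennreal ((1 + R) ^ m) * ennreal \<bar>g x\<bar> + weight_tail m R x * ennreal \<bar>g x\<bar>"
      unfolding distrib_right[symmetric] by (rule mult_right_mono) simp
  qed
  also have "\<dots> = ennreal ((1 + R) ^ m) * (\<integral>\<^sup>+x. ennreal \<bar>g x\<bar> \<partial>lborel) + (\<integral>\<^sup>+x. weight_tail m R x * ennreal \<bar>g x\<bar> \<partial>lborel)"
    by (subst nn_integral_add) (simp_all add: nn_integral_cmult)
  finally show ?thesis .
qed

text \<open>Inside a ball the weight is bounded and continuity in \<open>L1\<close> suffices;
  outside, the tails of \<open>u s\<close> and \<open>u t\<close> are small uniformly on bounded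
  time intervals. The radius can therefore be fixed before \<open>s\<close> tends to
  \<open>t\<close>.\<close>

lemma continuous_into_L1w:
  fixes \<phi> :: "real ^ 'n \<Rightarrow> real" and u :: "real \<Rightarrow> real ^ 'n \<Rightarrow> real"
  assumes u: "continuous_into (Lq 1) (Lq_norm 1) {0..} u"
    and \<phi>: "\<phi> \<in> L1w m" and "0 < B"
    and le: "\<And>t \<psi>. 0 \<le> t \<Longrightarrow> \<psi> \<in> borel_measurable borel \<Longrightarrow>
      (\<integral>\<^sup>+x. \<psi> x * ennreal \<bar>u t x\<bar> \<partial>lborel) \<le> ennreal B * (\<integral>\<^sup>+x. heat_nn t \<psi> x * ennreal \<bar>\<phi> x\<bar> \<partial>lborel)"
  shows "continuous_into (L1w m) (L1w_norm m) {0..} u"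
proof -
  have umeas: "u t \<in> borel_measurable borel" if "0 \<le> t" for t
    using u that by (simp add: continuous_into_def Lq_def)
  have \<phi>meas: "\<phi> \<in> borel_measurable borel"
    using \<phi> by (simp add: L1w_def Lq_def)
  let ?t = "\<lambda>k t. \<integral>\<^sup>+x. weight_tail m (real k) x * ennreal \<bar>u t x\<bar> \<partial>lborel"
  have tail: "\<exists>k. \<forall>t\<in>{0..T}. ?t k t \<le> ennreal e" if "0 < e" for e T
  proof -
    \<comment> \<open>Dividing by \<open>B\<close> compensates the factor in
      \<open>le\<close>.\<close>
    have "0 < ennreal (e / B)"
      using that \<open>0 < B\<close> by simp
    then obtain k :: nat where k: "\<And>t. 0 \<le> t \<Longrightarrow> t \<le> T \<Longrightarrow>
        (\<integral>\<^sup>+y. heat_nn t (weight_tail m (real k)) y * ennreal \<bar>\<phi> y\<bar> \<partial>lborel) < ennreal (e / B)"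
      using heat_nn_weight_tail_uniform[OF \<phi>meas L1w_weight_finite[OF \<phi>], of "ennreal (e / B)" T] by blast
    have "?t k t \<le> ennreal e" if t: "t \<in> {0..T}" for t
    proof -
      have "?t k t \<le> ennreal B * (\<integral>\<^sup>+y. heat_nn t (weight_tail m (real k)) y * ennreal \<bar>\<phi> y\<bar> \<partial>lborel)"
        using t by (intro le) auto
      also have "\<dots> \<le> ennreal B * ennreal (e / B)"
        using t by (intro mult_left_mono less_imp_le[OF k]) auto
      finally show ?thesis
        using \<open>0 < B\<close> \<open>0 < e\<close> by (simp add: ennreal_mult[symmetric])
    qed
    then show ?thesis
      by blast
  qed
  let ?w = "\<lambda>g. \<integral>\<^sup>+x. ennreal ((1 + norm x) ^ m) * ennreal \<bar>g x\<bar> \<partial>(lborel :: (real ^ 'n) measure)"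
  have "u t \<in> L1w m" if t: "0 \<le> t" for t
  proof (rule L1w_I[OF umeas[OF t]])
    obtain k where k: "\<forall>s\<in>{0..t}. ?t k s \<le> ennreal 1"
      using tail[OF zero_less_one, of t] by blast
    then have "?t k t \<le> ennreal 1"
      using t by simp
    moreover have "(\<integral>\<^sup>+x. ennreal \<bar>u t x\<bar> \<partial>lborel) < \<infinity>"
      using u t by (simp add: continuous_into_def Lq_def Lq_norm_1)
    ultimately have "ennreal ((1 + real k) ^ m) * (\<integral>\<^sup>+x. ennreal \<bar>u t x\<bar> \<partial>lborel) + ?t k t < \<infinity>"
      by (auto simp: ennreal_mult_less_top intro: le_less_trans)
    then show "?w (u t) < \<infinity>"
      using nn_integral_weight_split[OF umeas[OF t], of "real k" m] by (auto intro: le_less_trans)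
  qed
  moreover have "((\<lambda>s. L1w_norm m (\<lambda>x. u s x - u t x)) \<longlongrightarrow> 0) (at t within {0..})" if t: "0 \<le> t" for t
  proof -
    have small: "eventually (\<lambda>s. ?w (\<lambda>x. u s x - u t x) \<le> ennreal e) (at t within {0..})" if e: "0 < e" for e
    proof -
      \<comment> \<open>One third is for the ball and one for each of the two tails. The time
        interval up to \<open>t + 1\<close> contains every admissible \<open>s\<close> near
        \<open>t\<close>.\<close>
      have "0 < e / 3"
        using e by simp
      then obtain k where k: "\<forall>s\<in>{0..t + 1}. ?t k s \<le> ennreal (e / 3)"
        using tail by blast
      have "((\<lambda>s. \<integral>\<^sup>+x. ennreal \<bar>u s x - u t x\<bar> \<partial>lborel) \<longlongrightarrow> 0) (at t within {0..})"
        using u t by (simp add: continuous_into_def Lq_norm_1)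
      from tendsto_mult_ennreal[OF tendsto_const this, of "ennreal ((1 + real k) ^ m)"]
      have "((\<lambda>s. ennreal ((1 + real k) ^ m) * (\<integral>\<^sup>+x. ennreal \<bar>u s x - u t x\<bar> \<partial>lborel)) \<longlongrightarrow> 0) (at t within {0..})"
        by simp
      then have "eventually (\<lambda>s. ennreal ((1 + real k) ^ m) * (\<integral>\<^sup>+x. ennreal \<bar>u s x - u t x\<bar> \<partial>lborel) < ennreal (e / 3)) (at t within {0..})"
        using e by (intro order_tendstoD) auto
      moreover have "eventually (\<lambda>s. s \<in> {0..t + 1}) (at t within {0..})"
        unfolding eventually_at using t by (intro exI[of _ 1]) (auto simp: dist_real_def)
      ultimately show ?thesis
      proof eventually_elim
        case (elim s)
        then have [measurable]: "u s \<in> borel_measurable borel" "u t \<in> borel_measurable borel"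
          using umeas t by auto
        have "(\<integral>\<^sup>+x. weight_tail m (real k) x * ennreal \<bar>u s x - u t x\<bar> \<partial>lborel) \<le>
            (\<integral>\<^sup>+x. weight_tail m (real k) x * ennreal \<bar>u s x\<bar> + weight_tail m (real k) x * ennreal \<bar>u t x\<bar> \<partial>lborel)"
          unfolding distrib_left[symmetric]
          by (intro nn_integral_mono mult_left_mono)
             (auto simp del: ennreal_plus simp: ennreal_plus[symmetric] intro!: ennreal_leI)
        also have "\<dots> = ?t k s + ?t k t"
          by (rule nn_integral_add) measurable
        also have "\<dots> \<le> ennreal (e / 3) + ennreal (e / 3)"
          using elim t by (intro add_mono bspec[OF k]) auto
        finally have "ennreal ((1 + real k) ^ m) * (\<integral>\<^sup>+x. ennreal \<bar>u s x - u t x\<bar> \<partial>lborel) +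
            (\<integral>\<^sup>+x. weight_tail m (real k) x * ennreal \<bar>u s x - u t x\<bar> \<partial>lborel) \<le>
            ennreal (e / 3) + (ennreal (e / 3) + ennreal (e / 3))"
          using elim(1) by (intro add_mono) auto
        also have "\<dots> = ennreal e"
          using e by (simp add: ennreal_plus[symmetric] del: ennreal_plus)
        finally show ?case
          by (intro order_trans[OF nn_integral_weight_split]) auto
      qed
    qed
    have lim: "((\<lambda>s. ?w (\<lambda>x. u s x - u t x)) \<longlongrightarrow> 0) (at t within {0..})"
    proof (rule order_tendstoI)
      fix a :: ennreal
      assume "0 < a"
      \<comment> \<open>\<open>a\<close> may be infinite, so a finite positive level below it is
        chosen.\<close>
      then obtain b where b: "0 < b" "b < a"
        using dense by blast
      then obtain e where e: "b = ennreal e" "0 < e"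
        by (cases b) auto
      show "eventually (\<lambda>s. ?w (\<lambda>x. u s x - u t x) < a) (at t within {0..})"
        using small[OF e(2)] b(2) unfolding e(1) by (auto elim!: eventually_mono intro: le_less_trans)
    qed simp
    show ?thesis
    proof (rule tendsto_sandwich[OF _ _ tendsto_const])
      let ?c = "of_nat (card {\<alpha> :: 'n \<Rightarrow> nat. mi_length \<alpha> \<le> m}) :: ennreal"
      show "((\<lambda>s. ?c * ?w (\<lambda>x. u s x - u t x)) \<longlongrightarrow> 0) (at t within {0..})"
        using tendsto_mult_ennreal[OF tendsto_const lim, of ?c] by simp
      show "\<forall>\<^sub>F s in at t within {0..}. L1w_norm m (\<lambda>x. u s x - u t x) \<le> ?c * ?w (\<lambda>x. u s x - u t x)"
        by (intro always_eventually allI L1w_norm_le)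
    qed simp
  qed
  ultimately show ?thesis
    by (simp add: continuous_into_def)
qed

text \<open>The weight \<open>norm x ^ m\<close> dominates every monomial of degree
  \<open>m\<close>. Testing \<open>le\<close> with it reduces the claim to the Gaussian moment bound
  on the heat evolution of this weight.\<close>

lemma moment_growth:
  fixes \<phi> :: "real ^ 'n \<Rightarrow> real" and u :: "real \<Rightarrow> real ^ 'n \<Rightarrow> real"
  assumes \<phi>: "\<phi> \<in> L1w m" and "0 < m" and "0 < B"
    and le: "\<And>t \<psi>. 0 \<le> t \<Longrightarrow> \<psi> \<in> borel_measurable borel \<Longrightarrow>
      (\<integral>\<^sup>+x. \<psi> x * ennreal \<bar>u t x\<bar> \<partial>lborel) \<le> ennreal B * (\<integral>\<^sup>+x. heat_nn t \<psi> x * ennreal \<bar>\<phi> x\<bar> \<partial>lborel)"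
  shows "\<exists>C>0. \<forall>t\<ge>0. (\<Sum>\<alpha> | mi_length \<alpha> = m. Lq_norm 1 (\<lambda>x. mi_power x \<alpha> * u t x))
    \<le> ennreal (C * (1 + t powr (real m / 2)))"
proof -
  have [measurable]: "\<phi> \<in> borel_measurable borel"
    using \<phi> by (simp add: L1w_def Lq_def)
  obtain D where D: "0 < D" "\<And>t (y :: real ^ 'n). 0 \<le> t \<Longrightarrow>
      heat_nn t (\<lambda>x. ennreal (norm x ^ m)) y \<le> ennreal (D * (norm y ^ m + sqrt t ^ m))"
    using heat_nn_moment_le by blast
  let ?W = "\<integral>\<^sup>+x. ennreal ((1 + norm x) ^ m) * ennreal \<bar>\<phi> x\<bar> \<partial>lborel"
  obtain W where W: "?W = ennreal W" "0 \<le> W"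
    using L1w_weight_finite[OF \<phi>] by (cases ?W) auto
  define N where "N = card {\<alpha> :: 'n \<Rightarrow> nat. mi_length \<alpha> = m}"
  have "(\<Sum>\<alpha> | mi_length \<alpha> = m. Lq_norm 1 (\<lambda>x. mi_power x \<alpha> * u t x))
      \<le> ennreal ((real N * B * D * W + 1) * (1 + t powr (real m / 2)))" if t: "0 \<le> t" for t
  proof -
    let ?s = "1 + t powr (real m / 2)"
    \<comment> \<open>At \<open>t = 0\<close> both sides vanish because \<open>m\<close> is
      positive; for \<open>m = 0\<close> the conventions \<open>0 ^ 0 = 1\<close> and
      \<open>0 powr 0 = 0\<close> would clash.\<close>
    have s: "sqrt t ^ m = t powr (real m / 2)"
      using t \<open>0 < m\<close> by (cases "t = 0") (simp_all add: powr_half_sqrt[symmetric] powr_realpow[symmetric] powr_powr)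
    have "Lq_norm 1 (\<lambda>x. mi_power x \<alpha> * u t x) \<le> (\<integral>\<^sup>+x. ennreal (norm x ^ m) * ennreal \<bar>u t x\<bar> \<partial>lborel)"
      if "mi_length \<alpha> = m" for \<alpha>
      unfolding Lq_norm_1
    proof (rule nn_integral_mono)
      fix x :: "real ^ 'n"
      show "ennreal \<bar>mi_power x \<alpha> * u t x\<bar> \<le> ennreal (norm x ^ m) * ennreal \<bar>u t x\<bar>"
        using abs_mi_power_le[of x \<alpha>] that
        by (subst ennreal_mult[symmetric]) (auto intro!: ennreal_leI mult_right_mono simp: abs_mult)
    qed
    then have "(\<Sum>\<alpha> | mi_length \<alpha> = m. Lq_norm 1 (\<lambda>x. mi_power x \<alpha> * u t x)) \<le>
        of_nat N * (\<integral>\<^sup>+x. ennreal (norm x ^ m) * ennreal \<bar>u t x\<bar> \<partial>lborel)"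
      unfolding N_def by (intro sum_bounded_above) auto
    also have "\<dots> \<le> of_nat N * (ennreal B * (\<integral>\<^sup>+y. heat_nn t (\<lambda>x. ennreal (norm x ^ m)) y * ennreal \<bar>\<phi> y\<bar> \<partial>lborel))"
      using t by (intro mult_left_mono le) auto
    also have "(\<integral>\<^sup>+y. heat_nn t (\<lambda>x. ennreal (norm x ^ m)) y * ennreal \<bar>\<phi> y\<bar> \<partial>lborel) \<le>
        (\<integral>\<^sup>+y. ennreal (D * ?s) * (ennreal ((1 + norm y) ^ m) * ennreal \<bar>\<phi> y\<bar>) \<partial>lborel)"
    proof (rule nn_integral_mono)
      fix y :: "real ^ 'n"
      have "norm y ^ m \<le> (1 + norm y) ^ m" "1 \<le> (1 + norm y) ^ m"
        by (auto intro!: power_mono one_le_power)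
      \<comment> \<open>Both \<open>norm y ^ m\<close> and 1 lie below
        \<open>(1 + norm y) ^ m\<close>, so the sum is absorbed by a factor in \<open>t\<close>
        times a factor in \<open>y\<close>, and the time factor leaves the integral.\<close>
      then have "norm y ^ m + sqrt t ^ m \<le> ?s * (1 + norm y) ^ m"
        using mult_left_mono[of 1 "(1 + norm y) ^ m" "t powr (real m / 2)"] unfolding s by (simp add: algebra_simps)
      then have "D * (norm y ^ m + sqrt t ^ m) \<le> D * ?s * (1 + norm y) ^ m"
        using D(1) by simp
      then have "heat_nn t (\<lambda>x. ennreal (norm x ^ m)) y \<le> ennreal (D * ?s * (1 + norm y) ^ m)"
        by (intro order_trans[OF D(2)[OF t]] ennreal_leI)
      also have "\<dots> = ennreal (D * ?s) * ennreal ((1 + norm y) ^ m)"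
        using D(1) by (intro ennreal_mult) auto
      finally show "heat_nn t (\<lambda>x. ennreal (norm x ^ m)) y * ennreal \<bar>\<phi> y\<bar> \<le>
          ennreal (D * ?s) * (ennreal ((1 + norm y) ^ m) * ennreal \<bar>\<phi> y\<bar>)"
        unfolding mult.assoc[symmetric] by (rule mult_right_mono) simp
    qed
    also have "\<dots> = ennreal (D * ?s) * ennreal W"
      by (simp add: nn_integral_cmult W(1))
    also have "of_nat N * (ennreal B * (ennreal (D * ?s) * ennreal W)) = ennreal (real N * B * D * W * ?s)"
      using \<open>0 < B\<close> D(1) W(2) by (simp add: ennreal_of_nat_eq_real_of_nat ennreal_mult[symmetric] mult_ac)
    \<comment> \<open>The summand 1 keeps the constant positive even when
      \<open>W = 0\<close>.\<close>
    also have "\<dots> \<le> ennreal ((real N * B * D * W + 1) * ?s)"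
      by (intro ennreal_leI mult_right_mono) auto
    finally show ?thesis
      by (simp add: mult_left_mono)
  qed
  then show ?thesis
    using \<open>0 < B\<close> D(1) W(2) by (intro exI[of _ "real N * B * D * W + 1"]) (auto intro!: add_nonneg_pos)
qed

theorem theorem1p2:
  fixes f :: "real \<Rightarrow> real" and K p eps0 :: real and m :: nat
    and \<phi> :: "real ^ 'n \<Rightarrow> real" and u :: "real \<Rightarrow> real ^ 'n \<Rightarrow> real"
  assumes "p > 1 + 2 / real CARD('n)"
    and "K > 0" and "nonlinearity f K p"
    and "eps0 > 0" and "smallness_constant TYPE('n) f eps0"
    and "m > 0"
    and "\<phi> \<in> L1w m \<inter> Lq \<infinity>" and "Lq_norm 1 \<phi> + Lq_norm \<infinity> \<phi> \<le> ennreal eps0"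
    and "global_solution f \<phi> u"
  shows "continuous_into (L1w m) (L1w_norm m) {0..} u \<and>
    (\<exists>C>0. \<forall>t\<ge>0.
       (\<Sum>\<alpha> | mi_length \<alpha> = m. Lq_norm 1 (\<lambda>x. mi_power x \<alpha> * u t x))
         \<le> ennreal (C * (1 + t powr (real m / 2))))"
proof -
  have \<phi>: "\<phi> \<in> L1w m" "\<phi> \<in> Lq 1"
    using assms by (auto simp: L1w_def)
  \<comment> \<open>The smallness constant provides a decaying solution with data
    \<open>\<phi>\<close>, and its uniqueness clause identifies it with \<open>u\<close> almost
    everywhere at each time. Thus \<open>u\<close> inherits the decay.\<close>
  then obtain v where v: "decaying v" "\<And>t. 0 \<le> t \<Longrightarrow> AE x in lborel. u t x = v t x"
    using assms unfolding smallness_constant_def by blast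
  obtain A where A: "0 < A"
    "\<And>t. 0 \<le> t \<Longrightarrow> AE x in lborel. \<bar>v t x\<bar> \<le> A * (1 + t) powr (- real CARD('n) / 2)"
    using decaying_sup_bound[OF v(1)] by blast
  have uA: "AE x in lborel. \<bar>u t x\<bar> \<le> A * (1 + t) powr (- real CARD('n) / 2)" if "0 \<le> t" for t
    using v(2)[OF that] A(2)[OF that] by eventually_elim simp
  obtain B where B: "0 < B" "\<And>t \<psi>. 0 \<le> t \<Longrightarrow> \<psi> \<in> borel_measurable borel \<Longrightarrow>
      (\<integral>\<^sup>+x. \<psi> x * ennreal \<bar>u t x\<bar> \<partial>lborel) \<le> ennreal B * (\<integral>\<^sup>+x. heat_nn t \<psi> x * ennreal \<bar>\<phi> x\<bar> \<partial>lborel)"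
    using solution_weighted_le[OF assms(1-3) A(1) uA \<phi>(2) assms(9)] by blast
  have "continuous_into (Lq 1) (Lq_norm 1) {0..} u"
    using assms(9) by (simp add: global_solution_def X_space_def)
  then show ?thesis
    using continuous_into_L1w[OF _ \<phi>(1) B] moment_growth[OF \<phi>(1) assms(6) B] by blast
qed

end
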